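(* The logic $\mathsf{IK4}$ has the finite model property: for every formula $\varphi\in\mathbb L$, if $\mathsf{IK4}\nvdash\varphi$, then there is an intuitionistic transitive model $\mathcal M$ with finite domain which falsifies $\varphi$, i.e. there is $w\in|\mathcal M|$ with $\mathcal M\not\models\varphi(w)$.
   Context: **Language.** Fix a countably infinite set $\mathbb P$ of propositional variables. The language $\mathbb L$ is given by $\varphi,\psi ::= p\mid\bot\mid(\varphi\wedge\psi)\mid(\varphi\vee\psi)\mid(\varphi\to\psi)\mid\Diamond\varphi\mid\Box\varphi$ with $p\in\mathbb P$; $\neg\varphi:=\varphi\to\bot$. **Logic.** $\mathsf{IK4}$ is the smallest set of formulas of $\mathbb L$ that contains all (substitution instances of) intuitionistic propositional tautologies and all substitution instances of the axioms $\Box(p\to q)\to(\Box p\to\Box q)$; $\Box(p\to q)\to(\Diamond p\to\Diamond q)$; $\Diamond(p\vee q)\to\Diamond p\vee\Diamond q$; $(\Diamond p\to\Box q)\to\Box(p\to q)$; $\neg\Diamond\bot$; $\Diamond\Diamond p\to\Diamond p$; $\Box p\to\Box\Box p$; and is closed under modus ponens and necessitation (from $\varphi$ infer $\Box\varphi$). $\mathsf{IK4}\vdash\varphi$ means $\varphi\in\mathsf{IK4}$. **Models.** An intuitionistic transitive model is a tuple $\mathcal M=(|\mathcal M|,\preccurlyeq,\sqsubset,[\![\cdot]\!])$ where $\sqsubset$ is a transitive relation on $|\mathcal M|$, $\preccurlyeq$ is a partial order on $|\mathcal M|$ that is expansive over $\sqsubset$, meaning: (forward confluence) if $x\sqsubset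 y$ and $x\preccurlyeq x'$ then there is $y'$ with $y\preccurlyeq y'$ and $x'\sqsubset y'$; (backward confluence) if $x\sqsubset y$ and $y\preccurlyeq y'$ then there is $x'$ with $x\preccurlyeq x'$ and $x'\sqsubset y'$; and $[\![\cdot]\!]:\mathbb P\to 2^{|\mathcal M|}$ is persistent: if $w\in[\![p]\!]$ and $w\preccurlyeq v$ then $v\in[\![p]\!]$. **Truth.** $\mathcal M\models\varphi(w)$ is defined by: $\mathcal M\models p(w)$ iff $w\in[\![p]\!]$; $\bot$ is never true; $\wedge,\vee$ are evaluated pointwise; $\mathcal M\models(\varphi\to\psi)(w)$ iff for all $v$ with $w\preccurlyeq v$, $\mathcal M\not\models\varphi(v)$ or $\mathcal M\models\psi(v)$; $\mathcal M\models\Diamond\varphi(w)$ iff there is $v$ with $w\sqsubset v$ and $\mathcal M\models\varphi(v)$; $\mathcal M\models\Box\varphi(w)$ iff $\mathcal M\models\varphi(v)$ for all $u,v$ with $w\preccurlyeq u\sqsubset v$. *)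

theory Defs
  imports Main "HOL-Library.Countable_Set"
begin

datatype 'p fm =
    Var 'p
  | Bot
  | Conj "'p fm" "'p fm"
  | Disj "'p fm" "'p fm"
  | Imp "'p fm" "'p fm"
  | Dia "'p fm"
  | Box "'p fm"

definition Neg :: "'p fm \<Rightarrow> 'p fm" where
  "Neg \<phi> = Imp \<phi> Bot"

primrec subst :: "('p \<Rightarrow> 'p fm) \<Rightarrow> 'p fm \<Rightarrow> 'p fm" where
  "subst \<sigma> (Var p) = \<sigma> p"
| "subst \<sigma> Bot = Bot"
| "subst \<sigma> (Conj \<phi> \<psi>) = Conj (subst \<sigma> \<phi>) (subst \<sigma> \<psi>)"
| "subst \<sigma> (Disj \<phi> \<psi>) = Disj (subst \<sigma> \<phi>) (subst \<sigma> \<psi>)"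
| "subst \<sigma> (Imp \<phi> \<psi>) = Imp (subst \<sigma> \<phi>) (subst \<sigma> \<psi>)"
| "subst \<sigma> (Dia \<phi>) = Dia (subst \<sigma> \<phi>)"
| "subst \<sigma> (Box \<phi>) = Box (subst \<sigma> \<phi>)"

primrec modality_free :: "'p fm \<Rightarrow> bool" where
  "modality_free (Var p) \<longleftrightarrow> True"
| "modality_free Bot \<longleftrightarrow> True"
| "modality_free (Conj \<phi> \<psi>) \<longleftrightarrow> modality_free \<phi> \<and> modality_free \<psi>"
| "modality_free (Disj \<phi> \<psi>) \<longleftrightarrow> modality_free \<phi> \<and> modality_free \<psi>"
| "modality_free (Imp \<phi> \<psi>) \<longleftrightarrow> modality_free \<phi> \<and> modality_free \<psi>"
| "modality_free (Dia \<phi>) \<longleftrightarrow> False"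
| "modality_free (Box \<phi>) \<longleftrightarrow> False"

text \<open>The intuitionistic propositional tautologies are the theorems of the usual Hilbert
  calculus for intuitionistic propositional logic, in the language without modalities.\<close>

inductive_set IPC :: "'p fm set" where
  IPC_K: "\<lbrakk>modality_free \<phi>; modality_free \<psi>\<rbrakk> \<Longrightarrow> Imp \<phi> (Imp \<psi> \<phi>) \<in> IPC"
| IPC_S: "\<lbrakk>modality_free \<phi>; modality_free \<psi>; modality_free \<chi>\<rbrakk> \<Longrightarrow>
    Imp (Imp \<phi> (Imp \<psi> \<chi>)) (Imp (Imp \<phi> \<psi>) (Imp \<phi> \<chi>)) \<in> IPC"
| IPC_conjE1: "\<lbrakk>modality_free \<phi>; modality_free \<psi>\<rbrakk> \<Longrightarrow> Imp (Conj \<phi> \<psi>) \<phi> \<in> IPC"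
| IPC_conjE2: "\<lbrakk>modality_free \<phi>; modality_free \<psi>\<rbrakk> \<Longrightarrow> Imp (Conj \<phi> \<psi>) \<psi> \<in> IPC"
| IPC_conjI: "\<lbrakk>modality_free \<phi>; modality_free \<psi>\<rbrakk> \<Longrightarrow>
    Imp \<phi> (Imp \<psi> (Conj \<phi> \<psi>)) \<in> IPC"
| IPC_disjI1: "\<lbrakk>modality_free \<phi>; modality_free \<psi>\<rbrakk> \<Longrightarrow> Imp \<phi> (Disj \<phi> \<psi>) \<in> IPC"
| IPC_disjI2: "\<lbrakk>modality_free \<phi>; modality_free \<psi>\<rbrakk> \<Longrightarrow> Imp \<psi> (Disj \<phi> \<psi>) \<in> IPC"
| IPC_disjE: "\<lbrakk>modality_free \<phi>; modality_free \<psi>; modality_free \<chi>\<rbrakk> \<Longrightarrow>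
    Imp (Imp \<phi> \<chi>) (Imp (Imp \<psi> \<chi>) (Imp (Disj \<phi> \<psi>) \<chi>)) \<in> IPC"
| IPC_efq: "modality_free \<phi> \<Longrightarrow> Imp Bot \<phi> \<in> IPC"
| IPC_mp: "\<lbrakk>Imp \<phi> \<psi> \<in> IPC; \<phi> \<in> IPC\<rbrakk> \<Longrightarrow> \<psi> \<in> IPC"

text \<open>The modal axioms are stated as schemes, that is, with arbitrary formulas already
  substituted for the variables \<open>p\<close> and \<open>q\<close>.\<close>

inductive_set IK4 :: "'p fm set" where
  taut: "\<phi> \<in> IPC \<Longrightarrow> subst \<sigma> \<phi> \<in> IK4"
| box_K: "Imp (Box (Imp \<phi> \<psi>)) (Imp (Box \<phi>) (Box \<psi>)) \<in> IK4"
| dia_K: "Imp (Box (Imp \<phi> \<psi>)) (Imp (Dia \<phi>) (Dia \<psi>)) \<in> IK4"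
| dia_disj: "Imp (Dia (Disj \<phi> \<psi>)) (Disj (Dia \<phi>) (Dia \<psi>)) \<in> IK4"
| dia_box: "Imp (Imp (Dia \<phi>) (Box \<psi>)) (Box (Imp \<phi> \<psi>)) \<in> IK4"
| dia_bot: "Neg (Dia Bot) \<in> IK4"
| dia_4: "Imp (Dia (Dia \<phi>)) (Dia \<phi>) \<in> IK4"
| box_4: "Imp (Box \<phi>) (Box (Box \<phi>)) \<in> IK4"
| mp: "\<lbrakk>Imp \<phi> \<psi> \<in> IK4; \<phi> \<in> IK4\<rbrakk> \<Longrightarrow> \<psi> \<in> IK4"
| nec: "\<phi> \<in> IK4 \<Longrightarrow> Box \<phi> \<in> IK4"

record ('w, 'p) model =
  worlds :: "'w set"
  le :: "'w rel"
  acc :: "'w rel"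
  val :: "'p \<Rightarrow> 'w set"

definition forward_confluent :: "'w rel \<Rightarrow> 'w rel \<Rightarrow> bool" where
  "forward_confluent L R \<longleftrightarrow>
    (\<forall>x x' y. (x, y) \<in> R \<and> (x, x') \<in> L \<longrightarrow> (\<exists>y'. (y, y') \<in> L \<and> (x', y') \<in> R))"

definition backward_confluent :: "'w rel \<Rightarrow> 'w rel \<Rightarrow> bool" where
  "backward_confluent L R \<longleftrightarrow>
    (\<forall>x y y'. (x, y) \<in> R \<and> (y, y') \<in> L \<longrightarrow> (\<exists>x'. (x, x') \<in> L \<and> (x', y') \<in> R))"

text \<open>Note that \<^const>\<open>partial_order_on\<close> also confines the relation to the
  carrier, so all relations and the valuation live on \<open>worlds M\<close>.\<close>

definition int_trans_model :: "('w, 'p) model \<Rightarrow> bool" where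
  "int_trans_model M \<longleftrightarrow>
    acc M \<subseteq> worlds M \<times> worlds M \<and>
    trans (acc M) \<and>
    partial_order_on (worlds M) (le M) \<and>
    forward_confluent (le M) (acc M) \<and>
    backward_confluent (le M) (acc M) \<and>
    (\<forall>p. val M p \<subseteq> worlds M) \<and>
    (\<forall>p w v. w \<in> val M p \<and> (w, v) \<in> le M \<longrightarrow> v \<in> val M p)"

primrec holds :: "('w, 'p) model \<Rightarrow> 'p fm \<Rightarrow> 'w \<Rightarrow> bool" where
  "holds M (Var p) w \<longleftrightarrow> w \<in> val M p"
| "holds M Bot w \<longleftrightarrow> False"
| "holds M (Conj \<phi> \<psi>) w \<longleftrightarrow> holds M \<phi> w \<and> holds M \<psi> w"
| "holds M (Disj \<phi> \<psi>) w \<longleftrightarrow> holds M \<phi> w \<or> holds M \<psi> w"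
| "holds M (Imp \<phi> \<psi>) w \<longleftrightarrow> (\<forall>v. (w, v) \<in> le M \<longrightarrow> \<not> holds M \<phi> v \<or> holds M \<psi> v)"
| "holds M (Dia \<phi>) w \<longleftrightarrow> (\<exists>v. (w, v) \<in> acc M \<and> holds M \<phi> v)"
| "holds M (Box \<phi>) w \<longleftrightarrow> (\<forall>u v. (w, u) \<in> le M \<and> (u, v) \<in> acc M \<longrightarrow> holds M \<phi> v)"

end

theory Submission
  imports Defs "HOL-Library.Sublist"
begin

text \<open>The prime theories form the canonical model, whose worlds are restricted to types over the
  finite set \<open>\<Sigma>\<close> of subformulas of \<open>\<phi>\<close>. The two confluence conditions say exactly that a homomorphism
  from a finite tree into the canonical model can be raised along the partial order at any single
  node. So consider the finite trees labelled by \<open>\<Sigma>\<close>-types that have a label-preserving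
  homomorphism into the canonical model, together with a distinguished node, and order these pointed
  trees by homomorphism. A Kruskal-type argument shows that this is a well-quasi-order, so it
  is a union of finitely many maximal ideals. These ideals are the worlds of the finite model.

  An ideal \<open>J\<close> lies below \<open>K\<close> if the labels of every member of \<open>J\<close> can be enlarged to yield a member of
  \<open>K\<close>, and the accessible pairs are the two projections of the maximal ideals of trees with two
  distinguished comparable nodes. Both confluence conditions then follow because a homomorphism that
  moves one distinguished node moves the other one with it, and because a directed set covered by
  finitely many sets has a cofinal part in one of them. The relation between ideals is only a
  preorder, so one finally passes to the quotient and to the transitive closure of
  accessibility, which preserves both confluence conditions.\<close>

section \<open>Prime theories and the canonical model\<close>

text \<open>Identifying prime theories of equal \<open>\<Sigma>\<close>-type also gives finitely
  many points, but then a step up and a step across may be witnessed by different representatives,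
  so confluence need not survive. An ideal instead collects mutually compatible finite surroundings
  of a point: any two of its members fit into a third. Maximality is what makes witnesses exact. The
  pigeonhole argument only yields an ideal that contains a prescribed world; maximality of that
  world turns inclusion into equality, so a diamond or a confluence square is completed at the given
  world and not merely at a larger ideal. Confluence of the canonical model is not what makes the
  finite frame confluent. It is spent on raising a node of a realized tree, which provides the
  witnesses for implication and box. The two transitivity axioms are used twice: they allow
  homomorphisms to stretch a child step to a longer path, and they make boxed and diamond formulas
  travel along arrows, so that truth survives the transitive closure.\<close>

locale infinite_atoms =
  fixes atoms :: "'p set"
  assumes infinite_atoms: "infinite atoms"
begin

text \<open>Tautologies enter \<open>IK4\<close> only as substitution instances of modality-free
  formulas. To obtain a scheme in three metavariables for arbitrary modal formulas, three distinct
  variables are needed to substitute into.\<close>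

lemma schematic_instance:
  fixes A B C :: "'p fm"
  obtains \<sigma> :: "'p \<Rightarrow> 'p fm" and p q r where "\<sigma> p = A" "\<sigma> q = B" "\<sigma> r = C"
proof -
  obtain X where X: "X \<subseteq> atoms" "finite X" "card X = 3"
    using infinite_arbitrarily_large[OF infinite_atoms] by blast
  then obtain p q r where "X = {p, q, r}" and q: "q \<noteq> p" and r: "r \<noteq> p" "r \<noteq> q"
    by (metis card_3_iff)
  show thesis
    by (rule that[of "\<lambda>x. if x = p then A else if x = q then B else C" p q r]) (use q r in auto)
qed

lemma IPC_instance:
  fixes A B C :: "'p fm"
  assumes "\<And>p q r. F (Var p) (Var q) (Var r) \<in> IPC"
    and "\<And>\<sigma> p q r. subst \<sigma> (F (Var p) (Var q) (Var r)) = F (\<sigma> p) (\<sigma> q) (\<sigma> r)"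
  shows "F A B C \<in> IK4"
proof -
  obtain \<sigma> :: "'p \<Rightarrow> 'p fm" and p q r where "\<sigma> p = A" "\<sigma> q = B" "\<sigma> r = C"
    by (rule schematic_instance)
  then show ?thesis using taut[OF assms(1), of \<sigma> p q r] assms(2) by simp
qed

lemma IK4_K: "Imp A (Imp B A) \<in> (IK4 :: 'p fm set)"
  using IPC_instance[of "\<lambda>A B C. Imp A (Imp B A)" A B Bot] by (simp add: IPC_K)

lemma IK4_S: "Imp (Imp A (Imp B C)) (Imp (Imp A B) (Imp A C)) \<in> (IK4 :: 'p fm set)"
  using IPC_instance[of "\<lambda>A B C. Imp (Imp A (Imp B C)) (Imp (Imp A B) (Imp A C))" A B C] by (simp add: IPC_S)

lemma IK4_conjE1: "Imp (Conj A B) A \<in> (IK4 :: 'p fm set)"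
  using IPC_instance[of "\<lambda>A B C. Imp (Conj A B) A" A B Bot] by (simp add: IPC_conjE1)

lemma IK4_conjE2: "Imp (Conj A B) B \<in> (IK4 :: 'p fm set)"
  using IPC_instance[of "\<lambda>A B C. Imp (Conj A B) B" A B Bot] by (simp add: IPC_conjE2)

lemma IK4_conjI: "Imp A (Imp B (Conj A B)) \<in> (IK4 :: 'p fm set)"
  using IPC_instance[of "\<lambda>A B C. Imp A (Imp B (Conj A B))" A B Bot] by (simp add: IPC_conjI)

lemma IK4_disjI1: "Imp A (Disj A B) \<in> (IK4 :: 'p fm set)"
  using IPC_instance[of "\<lambda>A B C. Imp A (Disj A B)" A B Bot] by (simp add: IPC_disjI1)

lemma IK4_disjI2: "Imp B (Disj A B) \<in> (IK4 :: 'p fm set)"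
  using IPC_instance[of "\<lambda>A B C. Imp B (Disj A B)" A B Bot] by (simp add: IPC_disjI2)

lemma IK4_disjE: "Imp (Imp A C) (Imp (Imp B C) (Imp (Disj A B) C)) \<in> (IK4 :: 'p fm set)"
  using IPC_instance[of "\<lambda>A B C. Imp (Imp A C) (Imp (Imp B C) (Imp (Disj A B) C))" A B C] by (simp add: IPC_disjE)

lemma IK4_efq: "Imp Bot A \<in> (IK4 :: 'p fm set)"
  using IPC_instance[of "\<lambda>A B C. Imp Bot A" A Bot Bot] by (simp add: IPC_efq)

section \<open>Theories, local derivability and prime extensions\<close>

definition ik4_theory :: "'p fm set \<Rightarrow> bool" where
  "ik4_theory T \<longleftrightarrow> IK4 \<subseteq> T \<and> (\<forall>A B. Imp A B \<in> T \<longrightarrow> A \<in> T \<longrightarrow> B \<in> T)"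

definition prime :: "'p fm set \<Rightarrow> bool" where
  "prime T \<longleftrightarrow> ik4_theory T \<and> Bot \<notin> T \<and> (\<forall>A B. Disj A B \<in> T \<longrightarrow> A \<in> T \<or> B \<in> T)"

text \<open>A local consequence relation: necessitation is applied inside \<open>IK4\<close> only,
  never to members of \<open>\<Gamma>\<close>. This is what makes the deduction theorem
  hold.\<close>

inductive_set deriv :: "'p fm set \<Rightarrow> 'p fm set" for \<Gamma> where
  deriv_base: "A \<in> \<Gamma> \<Longrightarrow> A \<in> deriv \<Gamma>"
| deriv_IK4: "A \<in> IK4 \<Longrightarrow> A \<in> deriv \<Gamma>"
| deriv_mp: "\<lbrakk>Imp A B \<in> deriv \<Gamma>; A \<in> deriv \<Gamma>\<rbrakk> \<Longrightarrow> B \<in> deriv \<Gamma>"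

lemma ik4_theory_deriv: "ik4_theory (deriv \<Gamma>)"
  unfolding ik4_theory_def by (blast intro: deriv.intros)

lemma subset_deriv: "\<Gamma> \<subseteq> deriv \<Gamma>"
  by (blast intro: deriv_base)

lemma ik4_theory_IK4: "ik4_theory IK4"
  unfolding ik4_theory_def by (blast intro: IK4.mp)

lemma prime_theory: "prime T \<Longrightarrow> ik4_theory T"
  by (simp add: prime_def)

context
  fixes T
  assumes T: "ik4_theory T"
begin

lemma theory_axiom: "A \<in> IK4 \<Longrightarrow> A \<in> T"
  using T by (auto simp: ik4_theory_def)

lemma theory_mp: "Imp A B \<in> T \<Longrightarrow> A \<in> T \<Longrightarrow> B \<in> T"
  using T by (auto simp: ik4_theory_def)

lemma theory_weaken: "A \<in> T \<Longrightarrow> Imp B A \<in> T"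
  by (rule theory_mp[OF theory_axiom[OF IK4_K]])

lemma theory_imp_mp: "Imp A (Imp B C) \<in> T \<Longrightarrow> Imp A B \<in> T \<Longrightarrow> Imp A C \<in> T"
  by (rule theory_mp[OF theory_mp[OF theory_axiom[OF IK4_S]]])

lemma theory_imp_refl: "Imp A A \<in> T"
  by (rule theory_imp_mp[OF theory_axiom[OF IK4_K] theory_axiom[OF IK4_K[of A A]]])

lemma theory_imp_trans: "Imp A B \<in> T \<Longrightarrow> Imp B C \<in> T \<Longrightarrow> Imp A C \<in> T"
  by (rule theory_imp_mp[OF theory_weaken])

lemma theory_Conj_iff: "Conj A B \<in> T \<longleftrightarrow> A \<in> T \<and> B \<in> T"
  using theory_mp[OF theory_axiom[OF IK4_conjE1[of A B]]]
    theory_mp[OF theory_axiom[OF IK4_conjE2[of A B]]]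
    theory_mp[OF theory_mp[OF theory_axiom[OF IK4_conjI[of A B]]]] by iprover

lemma theory_DisjI: "A \<in> T \<or> B \<in> T \<Longrightarrow> Disj A B \<in> T"
  using theory_mp[OF theory_axiom[OF IK4_disjI1[of A B]]]
    theory_mp[OF theory_axiom[OF IK4_disjI2[of B A]]] by iprover

lemma theory_DisjE: "Imp A C \<in> T \<Longrightarrow> Imp B C \<in> T \<Longrightarrow> Imp (Disj A B) C \<in> T"
  by (rule theory_mp[OF theory_mp[OF theory_axiom[OF IK4_disjE]]])

lemma theory_dia_mono: "Box (Imp A B) \<in> T \<Longrightarrow> Dia A \<in> T \<Longrightarrow> Dia B \<in> T"
  by (rule theory_mp[OF theory_mp[OF theory_axiom[OF dia_K]]])

lemma theory_unbox: "ik4_theory {A. Box A \<in> T}"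
  unfolding ik4_theory_def
proof (intro conjI allI impI subsetI)
  show "A \<in> {A. Box A \<in> T}" if "A \<in> IK4" for A
    using that by (simp add: nec theory_axiom)
  show "B \<in> {A. Box A \<in> T}"
    if "Imp A B \<in> {A. Box A \<in> T}" "A \<in> {A. Box A \<in> T}" for A B
    using that theory_mp[OF theory_mp[OF theory_axiom[OF box_K[of A B]]]] by simp
qed

text \<open>Compactness without finite conjunctions. A derivation uses finitely many members of
  \<open>Y\<close>, and since any two of them follow from a third over \<open>T\<close>, a single
  member can replace them all. \<open>Y\<close> will be a singleton, a prime theory (directed by
  conjunction) or a set of diamonds.\<close>

lemma deriv_directed:
  assumes "X \<in> deriv (T \<union> Y)" and "Y \<noteq> {}"
    and dir: "\<And>C D. C \<in> Y \<Longrightarrow> D \<in> Y \<Longrightarrow> \<exists>E\<in>Y. Imp E C \<in> T \<and> Imp E D \<in> T"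
  shows "\<exists>C\<in>Y. Imp C X \<in> T"
  using assms(1)
proof induction
  case (deriv_base A)
  then show ?case using \<open>Y \<noteq> {}\<close> theory_weaken theory_imp_refl by blast
next
  case (deriv_IK4 A)
  then show ?case using \<open>Y \<noteq> {}\<close> theory_weaken theory_axiom by blast
next
  case (deriv_mp A B)
  then obtain C D where "C \<in> Y" "D \<in> Y" "Imp C (Imp A B) \<in> T" "Imp D A \<in> T" by blast
  then show ?case using dir theory_imp_trans theory_imp_mp by meson
qed

lemma deduction:
  assumes "X \<in> deriv (insert A T)"
  shows "Imp A X \<in> T"
proof -
  have "\<exists>C\<in>{A}. Imp C X \<in> T"
    by (rule deriv_directed) (use assms theory_imp_refl[of A] in simp_all)
  then show ?thesis by simp
qed

text \<open>The prime filter theorem. Take a maximal theory \<open>w\<close> above \<open>T\<close>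
  that misses \<open>\<Delta>\<close>. By maximality every formula outside \<open>w\<close> implies
  over \<open>w\<close> some member of \<open>\<Delta>\<close>; if both disjuncts were outside, the
  disjunction of the two members would lie in \<open>w\<close> and, by closure, in
  \<open>\<Delta>\<close>. Consistency follows from ex falso, as \<open>\<Delta>\<close> is
  nonempty.\<close>

lemma prime_extension:
  assumes "\<Delta> \<noteq> {}" and disj: "T \<inter> \<Delta> = {}"
    and \<Delta>: "\<And>A B. A \<in> \<Delta> \<Longrightarrow> B \<in> \<Delta> \<Longrightarrow> Disj A B \<in> \<Delta>"
  shows "\<exists>w. prime w \<and> T \<subseteq> w \<and> w \<inter> \<Delta> = {}"
proof -
  define \<A> where "\<A> = {U. ik4_theory U \<and> T \<subseteq> U \<and> U \<inter> \<Delta> = {}}"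
  have "\<A> \<noteq> {}"
    using T disj by (auto simp: \<A>_def)
  moreover have "\<Union>\<C> \<in> \<A>" if ne: "\<C> \<noteq> {}" and ch: "subset.chain \<A> \<C>" for \<C>
  proof -
    have sub: "\<C> \<subseteq> \<A>" and cmp: "\<And>U V. U \<in> \<C> \<Longrightarrow> V \<in> \<C> \<Longrightarrow> U \<subseteq> V \<or> V \<subseteq> U"
      using ch by (auto simp: subset_chain_def)
    have mem: "\<And>U. U \<in> \<C> \<Longrightarrow> ik4_theory U \<and> T \<subseteq> U \<and> U \<inter> \<Delta> = {}"
      using sub by (auto simp: \<A>_def)
    obtain U0 where "U0 \<in> \<C>" using ne by blast
    have "B \<in> \<Union>\<C>" if AB: "Imp A B \<in> \<Union>\<C>" "A \<in> \<Union>\<C>" for A B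
    proof -
      obtain U V where UV: "U \<in> \<C>" "V \<in> \<C>" "Imp A B \<in> U" "A \<in> V" using AB by blast
      then obtain X where "X \<in> \<C>" "Imp A B \<in> X" "A \<in> X" using cmp by blast
      then show ?thesis using mem unfolding ik4_theory_def by blast
    qed
    moreover have "IK4 \<subseteq> \<Union>\<C>" "T \<subseteq> \<Union>\<C>"
      using \<open>U0 \<in> \<C>\<close> mem unfolding ik4_theory_def by blast+
    moreover have "\<Union>\<C> \<inter> \<Delta> = {}"
      using mem by blast
    ultimately show ?thesis
      by (simp add: \<A>_def ik4_theory_def)
  qed
  ultimately obtain w where w: "w \<in> \<A>" and max: "\<And>X. X \<in> \<A> \<Longrightarrow> w \<subseteq> X \<Longrightarrow> X = w"
    using subset_Zorn_nonempty[of \<A>] by blast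
  have th: "ik4_theory w" and wT: "T \<subseteq> w" and w\<Delta>: "w \<inter> \<Delta> = {}"
    using w by (auto simp: \<A>_def)
  have meet: "\<exists>C\<in>\<Delta>. Imp A C \<in> w" if "A \<notin> w" for A
  proof (rule ccontr)
    assume no: "\<not> ?thesis"
    have "deriv (insert A w) \<inter> \<Delta> = {}"
      using no infinite_atoms.deduction[OF infinite_atoms_axioms th] by blast
    moreover have "insert A w \<subseteq> deriv (insert A w)"
      by (blast intro: deriv_base)
    ultimately have "deriv (insert A w) = w"
      using max[of "deriv (insert A w)"] ik4_theory_deriv wT by (auto simp: \<A>_def)
    then show False
      using \<open>insert A w \<subseteq> deriv (insert A w)\<close> that by blast
  qed
  have "A \<in> w \<or> B \<in> w" if d: "Disj A B \<in> w" for A B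
  proof (rule ccontr)
    assume "\<not> ?thesis"
    then obtain C D where CD: "C \<in> \<Delta>" "D \<in> \<Delta>" "Imp A C \<in> w" "Imp B D \<in> w"
      using meet by blast
    have "Imp A (Disj C D) \<in> w" "Imp B (Disj C D) \<in> w"
      using CD IK4_disjI1 IK4_disjI2 infinite_atoms.theory_axiom[OF infinite_atoms_axioms th]
        infinite_atoms.theory_imp_trans[OF infinite_atoms_axioms th] by blast+
    then have "Disj C D \<in> w"
      using d infinite_atoms.theory_DisjE[OF infinite_atoms_axioms th]
        infinite_atoms.theory_mp[OF infinite_atoms_axioms th] by blast
    then show False using \<Delta> CD w\<Delta> by blast
  qed
  moreover have "Bot \<notin> w"
    using \<open>\<Delta> \<noteq> {}\<close> w\<Delta> IK4_efq th unfolding ik4_theory_def by blast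
  ultimately show ?thesis
    using th wT w\<Delta> by (auto simp: prime_def)
qed

lemma prime_avoiding:
  assumes "B \<notin> T"
  shows "\<exists>w. prime w \<and> T \<subseteq> w \<and> B \<notin> w"
proof -
  \<comment> \<open>\<open>{B}\<close> is not closed under disjunction; the formulas that imply
    \<open>B\<close> over \<open>T\<close> are, and avoiding them amounts to avoiding
    \<open>B\<close>.\<close>
  have "\<exists>w. prime w \<and> T \<subseteq> w \<and> w \<inter> {C. Imp C B \<in> T} = {}"
  proof (rule prime_extension)
    show "{C. Imp C B \<in> T} \<noteq> {}"
      using theory_imp_refl by blast
    show "T \<inter> {C. Imp C B \<in> T} = {}"
      using assms theory_mp by blast
    show "Disj C D \<in> {C. Imp C B \<in> T}"
      if "C \<in> {C. Imp C B \<in> T}" "D \<in> {C. Imp C B \<in> T}" for C D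
      using that theory_DisjE by simp
  qed
  then obtain w where "prime w" "T \<subseteq> w" "w \<inter> {C. Imp C B \<in> T} = {}" by blast
  then show ?thesis using theory_imp_refl[of B] by blast
qed

end

text \<open>Intuitionistically diamond is not the dual of box, so the relation has to control both:
  boxes are pushed forward and diamonds pulled back. Each half has its own transitivity
  axiom.\<close>

definition can_acc :: "'p fm set \<Rightarrow> 'p fm set \<Rightarrow> bool" where
  "can_acc w v \<longleftrightarrow> (\<forall>A. Box A \<in> w \<longrightarrow> A \<in> v) \<and> (\<forall>A\<in>v. Dia A \<in> w)"

lemma can_acc_trans:
  assumes "prime w" "can_acc w v" "can_acc v u"
  shows "can_acc w u"
  unfolding can_acc_def
proof (intro conjI allI ballI impI)
  have w: "ik4_theory w" using assms(1) by (rule prime_theory)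
  show "A \<in> u" if "Box A \<in> w" for A
    using that assms(2,3) theory_mp[OF w theory_axiom[OF w box_4[of A]]]
    unfolding can_acc_def by blast
  show "Dia A \<in> w" if "A \<in> u" for A
    using that assms(2,3) theory_mp[OF w theory_axiom[OF w dia_4[of A]]]
    unfolding can_acc_def by blast
qed

lemma can_acc_Box: "prime w \<Longrightarrow> can_acc w v \<Longrightarrow> Box A \<in> w \<Longrightarrow> A \<in> v \<and> Box A \<in> v"
  using theory_mp[OF prime_theory theory_axiom[OF prime_theory box_4[of A]], of w]
  by (simp add: can_acc_def)

lemma can_acc_Dia: "prime w \<Longrightarrow> can_acc w v \<Longrightarrow> A \<in> v \<or> Dia A \<in> v \<Longrightarrow> Dia A \<in> w"
  using theory_mp[OF prime_theory theory_axiom[OF prime_theory dia_4[of A]], of w]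
  by (auto simp: can_acc_def)

lemma can_imp_witness:
  assumes "prime w" "Imp A B \<notin> w"
  shows "\<exists>v. prime v \<and> w \<subseteq> v \<and> A \<in> v \<and> B \<notin> v"
proof -
  have "B \<notin> deriv (insert A w)"
    using assms deduction[OF prime_theory] by blast
  then obtain v where "prime v" "deriv (insert A w) \<subseteq> v" "B \<notin> v"
    using prime_avoiding[OF ik4_theory_deriv] by blast
  then show ?thesis using subset_deriv[of "insert A w"] by blast
qed

text \<open>The box half of \<open>can_acc\<close> is put into \<open>T\<close>, the diamond half
  into the avoided set of all \<open>C\<close> with \<open>Dia C\<close> outside \<open>w\<close>.
  That set is closed under disjunction by \<open>dia_disj\<close> and contains \<open>Bot\<close> by
  \<open>dia_bot\<close>.\<close>

lemma can_dia_avoid: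
  assumes "prime w" "ik4_theory T" "\<And>C. C \<in> T \<Longrightarrow> Dia C \<in> w" "{A. Box A \<in> w} \<subseteq> T"
  shows "\<exists>v. prime v \<and> T \<subseteq> v \<and> can_acc w v"
proof -
  let ?\<Delta> = "{C. Dia C \<notin> w}"
  have w: "ik4_theory w" using assms(1) by (rule prime_theory)
  have "Dia Bot \<notin> w"
    using assms(1) dia_bot theory_axiom[OF w] theory_mp[OF w] by (fastforce simp: prime_def Neg_def)
  moreover have "Disj A B \<in> ?\<Delta>" if "A \<in> ?\<Delta>" "B \<in> ?\<Delta>" for A B
    using that assms(1) dia_disj theory_axiom[OF w] theory_mp[OF w] unfolding prime_def by blast
  ultimately have "\<exists>v. prime v \<and> T \<subseteq> v \<and> v \<inter> ?\<Delta> = {}"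
    using assms(2,3) by (intro prime_extension) auto
  then show ?thesis using assms(4) unfolding can_acc_def by blast
qed

text \<open>If \<open>C\<close> follows from the unboxed part of \<open>x'\<close> and
  \<open>y\<close>, then \<open>Box (Imp D C)\<close> is in \<open>x'\<close> for one
  \<open>D\<close> in \<open>y\<close>. As \<open>Dia D\<close> is in \<open>x\<close> and hence in
  \<open>x'\<close>, axiom \<open>dia_K\<close> gives \<open>Dia C\<close> in \<open>x'\<close>,
  which is what \<open>can_dia_avoid\<close> requires.\<close>

lemma can_forward:
  assumes "prime x" "prime x'" "prime y" "can_acc x y" "x \<subseteq> x'"
  shows "\<exists>y'. prime y' \<and> y \<subseteq> y' \<and> can_acc x' y'"
proof -
  let ?U = "{A. Box A \<in> x'}"
  have U: "ik4_theory ?U"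
    using assms(2) by (intro theory_unbox prime_theory)
  have "Dia C \<in> x'" if "C \<in> deriv (?U \<union> y)" for C
  proof -
    have "\<exists>D\<in>y. Imp D C \<in> ?U"
    proof (rule deriv_directed[OF U that])
      show "y \<noteq> {}"
        using IK4_K theory_axiom[OF prime_theory[OF assms(3)]] by blast
      show "\<exists>E\<in>y. Imp E A \<in> ?U \<and> Imp E B \<in> ?U" if "A \<in> y" "B \<in> y" for A B
        using that theory_Conj_iff[OF prime_theory[OF assms(3)]] IK4_conjE1 IK4_conjE2
          theory_axiom[OF U] by blast
    qed
    then obtain D where "D \<in> y" "Box (Imp D C) \<in> x'" by blast
    moreover have "Dia D \<in> x'"
      using \<open>D \<in> y\<close> assms(4,5) unfolding can_acc_def by blast
    ultimately show ?thesis
      using theory_dia_mono[OF prime_theory[OF assms(2)]] by blast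
  qed
  then have "\<exists>v. prime v \<and> deriv (?U \<union> y) \<subseteq> v \<and> can_acc x' v"
    using assms(2) ik4_theory_deriv subset_deriv[of "?U \<union> y"] by (intro can_dia_avoid) auto
  then obtain v where "prime v" "can_acc x' v" and v: "deriv (?U \<union> y) \<subseteq> v"
    by (elim exE conjE)
  moreover have "y \<subseteq> v"
    by (rule order_trans[OF _ v]) (use subset_deriv[of "?U \<union> y"] in simp)
  ultimately show ?thesis by (intro exI conjI)
qed

lemma can_dia_witness:
  assumes "prime w" "Dia A \<in> w"
  shows "\<exists>v. prime v \<and> can_acc w v \<and> A \<in> v"
proof -
  let ?U = "{A. Box A \<in> w}"
  have w: "ik4_theory w" using assms(1) by (rule prime_theory)
  have "Dia C \<in> w" if "C \<in> deriv (insert A ?U)" for C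
  proof -
    have "Imp A C \<in> ?U"
      using theory_unbox[OF w] that by (rule deduction)
    then show ?thesis
      using theory_dia_mono[OF w _ assms(2), of C] by simp
  qed
  then have "\<exists>v. prime v \<and> deriv (insert A ?U) \<subseteq> v \<and> can_acc w v"
    using assms(1) ik4_theory_deriv subset_deriv[of "insert A ?U"] by (intro can_dia_avoid) auto
  then obtain v where "prime v" "can_acc w v" and v: "deriv (insert A ?U) \<subseteq> v"
    by (elim exE conjE)
  moreover have "A \<in> v"
    by (rule subsetD[OF v]) (simp add: deriv_base)
  ultimately show ?thesis by (intro exI conjI)
qed

text \<open>The place where \<open>dia_box\<close> enters. The theory \<open>u\<close> must contain
  \<open>w\<close> and all \<open>Dia C\<close> with \<open>C\<close> in \<open>v\<close>, yet no
  \<open>Box B\<close> with \<open>B\<close> outside \<open>v\<close>. A conflict would put some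
  \<open>Imp (Dia C) (Box B)\<close> into \<open>w\<close>; then \<open>Box (Imp C B)\<close> is in
  \<open>w\<close>, so \<open>Imp C B\<close> is in \<open>v\<close>, which is absurd. Only the box
  half of accessibility is assumed, which also allows the use in
  \<open>can_box_witness\<close>.\<close>

lemma can_backward:
  assumes "prime w" "prime v" "{A. Box A \<in> w} \<subseteq> v"
  shows "\<exists>u. prime u \<and> w \<subseteq> u \<and> can_acc u v"
proof -
  \<comment> \<open>The forbidden boxes alone are not closed under disjunction; the formulas that
    imply one of them are, because \<open>v\<close> is prime and \<open>Box B\<close> and
    \<open>Box B'\<close> both imply \<open>Box (Disj B B')\<close>.\<close>
  let ?\<Delta> = "{D. \<exists>B. B \<notin> v \<and> Imp D (Box B) \<in> w}"
  let ?T = "deriv (w \<union> Dia ` v)"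
  have w: "ik4_theory w" and v: "ik4_theory v"
    using assms(1,2) by (simp_all add: prime_theory)
  have Dia_mono: "Imp (Dia A) (Dia B) \<in> w" if "Imp A B \<in> IK4" for A B
    by (rule theory_mp[OF w theory_axiom[OF w dia_K] theory_axiom[OF w nec[OF that]]])
  have Box_mono: "Imp (Box A) (Box B) \<in> w" if "Imp A B \<in> IK4" for A B
    by (rule theory_mp[OF w theory_axiom[OF w box_K] theory_axiom[OF w nec[OF that]]])
  have "Bot \<notin> v" using assms(2) by (simp add: prime_def)
  then have "Box Bot \<in> ?\<Delta>"
    using theory_imp_refl[OF w, of "Box Bot"] by blast
  moreover have "?T \<inter> ?\<Delta> = {}"
  proof (rule ccontr)
    assume "?T \<inter> ?\<Delta> \<noteq> {}"
    then obtain D B where D: "D \<in> ?T" "B \<notin> v" "Imp D (Box B) \<in> w" by blast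
    have "Box B \<in> ?T"
      by (rule deriv_mp[OF deriv_base D(1)]) (use D(3) in simp)
    then have "\<exists>E\<in>Dia ` v. Imp E (Box B) \<in> w"
    proof (rule deriv_directed[OF w])
      show "Dia ` v \<noteq> {}"
        using theory_imp_refl[OF v] by blast
      fix C D assume "C \<in> Dia ` v" "D \<in> Dia ` v"
      then obtain C' D' where CD: "C = Dia C'" "D = Dia D'" "C' \<in> v" "D' \<in> v" by blast
      then have "Conj C' D' \<in> v" using theory_Conj_iff[OF v] by blast
      moreover have "Imp (Dia (Conj C' D')) C \<in> w" "Imp (Dia (Conj C' D')) D \<in> w"
        using CD Dia_mono[OF IK4_conjE1] Dia_mono[OF IK4_conjE2] by auto
      ultimately show "\<exists>E\<in>Dia ` v. Imp E C \<in> w \<and> Imp E D \<in> w" by blast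
    qed
    then obtain C where "C \<in> v" "Imp (Dia C) (Box B) \<in> w" by blast
    then have "Box (Imp C B) \<in> w"
      by (intro theory_mp[OF w theory_axiom[OF w dia_box]])
    then have "Imp C B \<in> v"
      using assms(3) by auto
    then show False using \<open>C \<in> v\<close> \<open>B \<notin> v\<close> theory_mp[OF v] by simp
  qed
  moreover have "Disj C D \<in> ?\<Delta>" if CD: "C \<in> ?\<Delta>" "D \<in> ?\<Delta>" for C D
  proof -
    obtain B B' where B: "B \<notin> v" "Imp C (Box B) \<in> w" "B' \<notin> v" "Imp D (Box B') \<in> w"
      using CD by blast
    have "Disj B B' \<notin> v"
      using B assms(2) unfolding prime_def by blast
    moreover have "Imp (Disj C D) (Box (Disj B B')) \<in> w"
      using theory_imp_trans[OF w B(2) Box_mono[OF IK4_disjI1]]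
        theory_imp_trans[OF w B(4) Box_mono[OF IK4_disjI2]] by (rule theory_DisjE[OF w])
    ultimately show ?thesis by blast
  qed
  ultimately have "\<exists>u. prime u \<and> ?T \<subseteq> u \<and> u \<inter> ?\<Delta> = {}"
    by (intro prime_extension[OF ik4_theory_deriv]) auto
  then obtain u where u: "prime u" "?T \<subseteq> u" "u \<inter> ?\<Delta> = {}"
    by (elim exE conjE)
  have "w \<subseteq> u" "\<forall>A\<in>v. Dia A \<in> u"
    using u(2) subset_deriv[of "w \<union> Dia ` v"] by blast+
  moreover have "A \<in> v" if "Box A \<in> u" for A
    using that u(3) theory_imp_refl[OF w, of "Box A"] by auto
  ultimately show ?thesis using u(1) unfolding can_acc_def by blast
qed

text \<open>A prime \<open>v\<close> that contains the unboxed part of \<open>w\<close> and omits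
  \<open>A\<close> need not satisfy the diamond half of \<open>can_acc w v\<close>. Raising
  \<open>w\<close> to \<open>u\<close> repairs this, in accordance with the two-step clause for
  box.\<close>

lemma can_box_witness:
  assumes "prime w" "Box A \<notin> w"
  shows "\<exists>u v. prime u \<and> prime v \<and> w \<subseteq> u \<and> can_acc u v \<and> A \<notin> v"
proof -
  obtain v where "prime v" "{A. Box A \<in> w} \<subseteq> v" "A \<notin> v"
    using prime_avoiding[OF theory_unbox[OF prime_theory[OF assms(1)]], of A] assms(2) by auto
  then show ?thesis using can_backward[OF assms(1), of v] by auto
qed

end

section \<open>Well-quasi-ordering of finite labelled trees\<close>

definition tree :: "nat list set \<Rightarrow> bool" where
  "tree S \<longleftrightarrow> finite S \<and> [] \<in> S \<and> (\<forall>p k. p @ [k] \<in> S \<longrightarrow> p \<in> S)"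

lemma tree_leaf:
  assumes "tree S" "S \<noteq> {[]}"
  obtains q k where "q @ [k] \<in> S" "tree (S - {q @ [k]})" "\<And>j. q @ [k] @ [j] \<notin> S"
proof -
  have S: "finite S" "[] \<in> S" using assms(1) by (auto simp: tree_def)
  then have "Max (length ` S) \<in> length ` S" by (intro Max_in) auto
  then obtain p where p: "p \<in> S" "length p = Max (length ` S)" by auto
  then have len: "length p' \<le> length p" if "p' \<in> S" for p'
    using that S(1) by (simp add: Max_ge)
  have "p \<noteq> []"
  proof
    assume "p = []"
    then have "S \<subseteq> {[]}" using len by fastforce
    then show False using assms(2) S(2) by blast
  qed
  then obtain q k where qk: "p = q @ [k]" by (meson rev_exhaust)
  show thesis
  proof (rule that)
    show "q @ [k] \<in> S" using p(1) qk by simp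
    show leaf: "q @ [k] @ [j] \<notin> S" for j
      using len[of "q @ [k] @ [j]"] qk by auto
    show "tree (S - {q @ [k]})"
      using assms(1) leaf unfolding tree_def by (auto simp: append_assoc)
  qed
qed

text \<open>Deliberately weak: branches may be merged, a child may land at a deeper descendant, and
  the root need not go to the root. The weaker the notion, the easier the well-quasi-order;
  transitivity of canonical accessibility tolerates the stretching. Labels are compared by equality,
  as only finitely many occur.\<close>

definition tree_hom :: "(nat list \<Rightarrow> nat list) \<Rightarrow> nat list set \<times> (nat list \<Rightarrow> 'l) \<Rightarrow>
    nat list set \<times> (nat list \<Rightarrow> 'l) \<Rightarrow> bool" where
  "tree_hom h T T' \<longleftrightarrow> (\<forall>p \<in> fst T. h p \<in> fst T' \<and> snd T' (h p) = snd T p) \<and>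
    (\<forall>p \<in> fst T. \<forall>q \<in> fst T. strict_prefix p q \<longrightarrow> strict_prefix (h p) (h q))"

lemma tree_hom_id: "tree_hom id T T"
  by (simp add: tree_hom_def)

lemma tree_hom_comp: "tree_hom h T T' \<Longrightarrow> tree_hom h' T' T'' \<Longrightarrow> tree_hom (h' \<circ> h) T T''"
  by (simp add: tree_hom_def)

text \<open>The order condition does not mention labels, so any new labelling of the target can be
  pulled back along the same map. This is how enlarged labels are transported from one tree to
  another.\<close>

lemma tree_hom_relabel:
  "tree_hom h (S, lab) (S1, l1) \<Longrightarrow> S1 \<subseteq> S1' \<Longrightarrow> tree_hom h (S, l1' \<circ> h) (S1', l1')"
  by (auto simp: tree_hom_def)

definition maps_into :: "nat list set \<times> (nat list \<Rightarrow> 'l) \<Rightarrow>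
    nat list set \<times> (nat list \<Rightarrow> 'l) \<Rightarrow> bool" where
  "maps_into T T' \<longleftrightarrow> (\<exists>h. tree_hom h T T')"

lemma maps_into_trans: "maps_into T T' \<Longrightarrow> maps_into T' T'' \<Longrightarrow> maps_into T T''"
  unfolding maps_into_def using tree_hom_comp by blast

definition branch :: "nat \<Rightarrow> nat list set \<times> (nat list \<Rightarrow> 'l) \<Rightarrow>
    nat list set \<times> (nat list \<Rightarrow> 'l)" where
  "branch k T = ({p. k # p \<in> fst T}, \<lambda>p. snd T (k # p))"

definition branches :: "nat list set \<times> (nat list \<Rightarrow> 'l) \<Rightarrow>
    (nat list set \<times> (nat list \<Rightarrow> 'l)) set" where
  "branches T = (\<lambda>k. branch k T) ` {k. [k] \<in> fst T}"

lemma branches_maps_into: 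
  assumes "T' \<in> branches T"
  shows "maps_into T' T"
proof -
  obtain k where "T' = branch k T"
    using assms by (auto simp: branches_def)
  then have "tree_hom (Cons k) T' T"
    by (auto simp: tree_hom_def branch_def)
  then show ?thesis by (auto simp: maps_into_def)
qed

lemma finite_branches: "tree (fst T) \<Longrightarrow> finite (branches T)"
  unfolding branches_def tree_def
  by (intro finite_imageI finite_subset[of "{k. [k] \<in> fst T}" "hd ` fst T"]) force+

lemma fst_branch: "fst (branch k T) = {p. k # p \<in> fst T}"
  by (simp add: branch_def)

lemma tree_branch: "tree (fst T) \<Longrightarrow> [k] \<in> fst T \<Longrightarrow> tree (fst (branch k T))"
  unfolding tree_def fst_branch
  by (auto intro!: finite_subset[of "{p. k # p \<in> fst T}" "tl ` fst T"]) force

lemma card_branch: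
  assumes "tree (fst T)"
  shows "card (fst (branch k T)) < card (fst T)"
proof -
  have "card (fst (branch k T)) = card (Cons k ` fst (branch k T))"
    by (simp add: card_image)
  also have "\<dots> < card (fst T)"
    using assms by (intro psubset_card_mono) (auto simp: tree_def fst_branch)
  finally show ?thesis .
qed

lemma snd_branch_image: "snd (branch k T) ` fst (branch k T) \<subseteq> snd T ` fst T"
  by (auto simp: branch_def)

lemma tree_nonroot: "tree S \<Longrightarrow> k # p \<in> S \<Longrightarrow> [k] \<in> S"
proof (induction p rule: rev_induct)
  case (snoc x xs)
  then have "(k # xs) @ [x] \<in> S" by simp
  then show ?case using snoc unfolding tree_def by blast
qed simp

text \<open>Send root to root and use the given homomorphism on each branch. Several branches may be
  sent into the same one, so the choices for different children are independent.\<close>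

lemma maps_into_if_branches:
  assumes T: "tree (fst T)" "tree (fst T')" and root: "snd T [] = snd T' []"
    and br: "\<And>U. U \<in> branches T \<Longrightarrow> \<exists>U'\<in>branches T'. maps_into U U'"
  shows "maps_into T T'"
proof -
  have "\<exists>k' h. [k'] \<in> fst T' \<and> tree_hom h (branch k T) (branch k' T')" if "[k] \<in> fst T" for k
    using br[of "branch k T"] that unfolding branches_def maps_into_def by blast
  then obtain k' h where
    h: "\<And>k. [k] \<in> fst T \<Longrightarrow> [k' k] \<in> fst T' \<and> tree_hom (h k) (branch k T) (branch (k' k) T')"
    by metis
  define H where "H p = (case p of [] \<Rightarrow> [] | k # p \<Rightarrow> k' k # h k p)" for p
  have "tree_hom H T T'"
    unfolding tree_hom_def
  proof (intro conjI ballI impI)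
    fix p assume p: "p \<in> fst T"
    show "H p \<in> fst T'" "snd T' (H p) = snd T p"
    proof (atomize(full), cases p)
      case Nil
      then show "H p \<in> fst T' \<and> snd T' (H p) = snd T p"
        using T root by (simp add: H_def tree_def)
    next
      case (Cons k r)
      then have "tree_hom (h k) (branch k T) (branch (k' k) T')"
        using h tree_nonroot[OF T(1)] p by blast
      then show "H p \<in> fst T' \<and> snd T' (H p) = snd T p"
        using p Cons by (auto simp: H_def tree_hom_def branch_def)
    qed
    fix q assume q: "q \<in> fst T" and pq: "strict_prefix p q"
    show "strict_prefix (H p) (H q)"
    proof (cases p)
      case Nil
      then show ?thesis using pq by (auto simp: H_def split: list.splits)
    next
      case (Cons k r)
      then obtain s where s: "q = k # s" "strict_prefix r s"
        using pq by (cases q) auto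
      have "tree_hom (h k) (branch k T) (branch (k' k) T')"
        using h tree_nonroot[OF T(1)] p Cons by blast
      then show ?thesis
        using p q Cons s by (auto simp: H_def tree_hom_def branch_def)
    qed
  qed
  then show ?thesis by (auto simp: maps_into_def)
qed

section \<open>Minimal bad sequences and the Kruskal argument\<close>

definition wqo_on :: "('a \<Rightarrow> 'a \<Rightarrow> bool) \<Rightarrow> 'a set \<Rightarrow> bool" where
  "wqo_on r A \<longleftrightarrow> (\<forall>f :: nat \<Rightarrow> 'a. range f \<subseteq> A \<longrightarrow> (\<exists>i j. i < j \<and> r (f i) (f j)))"

lemma wqo_on_subset: "wqo_on r A \<Longrightarrow> B \<subseteq> A \<Longrightarrow> wqo_on r B"
  unfolding wqo_on_def by (meson order_trans)

text \<open>The construction of Nash-Williams: among the bad sequences with a fixed beginning, the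
  next term is chosen with least measure.\<close>

lemma minimal_bad_sequence:
  fixes m :: "'a \<Rightarrow> nat"
  assumes "\<not> wqo_on r A"
  obtains f :: "nat \<Rightarrow> 'a" where "range f \<subseteq> A" "\<And>i j. i < j \<Longrightarrow> \<not> r (f i) (f j)"
    "\<And>g n. range g \<subseteq> A \<Longrightarrow> \<forall>i j. i < j \<longrightarrow> \<not> r (g i) (g j) \<Longrightarrow>
      \<forall>i<n. g i = f i \<Longrightarrow> m (f n) \<le> m (g n)"
proof -
  define bad where "bad f \<longleftrightarrow> range f \<subseteq> A \<and> (\<forall>i j. i < j \<longrightarrow> \<not> r (f i) (f j))"
    for f :: "nat \<Rightarrow> 'a"
  define mini where "mini f n \<longleftrightarrow> (\<forall>g. bad g \<longrightarrow> (\<forall>i<n. g i = f i) \<longrightarrow> m (f n) \<le> m (g n))"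
    for f n
  have ex: "\<exists>g. bad g \<and> (\<forall>i<n. g i = f i) \<and> mini g n" if "bad f" for f n
  proof -
    define P where "P g \<longleftrightarrow> bad g \<and> (\<forall>i<n. g i = f i)" for g
    have "P f" using that by (simp add: P_def)
    then obtain g where g: "P g" "\<And>h. P h \<Longrightarrow> m (g n) \<le> m (h n)"
      using exists_least_iff[of "\<lambda>k. \<exists>g. P g \<and> m (g n) = k"] by (metis not_le)
    have "mini g n"
      unfolding mini_def
    proof (intro allI impI)
      fix h assume "bad h" "\<forall>i<n. h i = g i"
      then have "P h" using g(1) by (simp add: P_def)
      then show "m (g n) \<le> m (h n)" by (rule g(2))
    qed
    then show ?thesis using g(1) unfolding P_def by blast
  qed
  obtain f0 where "bad f0"
    using assms unfolding wqo_on_def bad_def by blast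
  \<comment> \<open>\<open>F n\<close> is a whole bad sequence, minimal at position
    \<open>n\<close>, and later ones keep its terms up to \<open>n\<close>. The diagonal is
    therefore bad and minimal at every position.\<close>
  have "\<exists>F :: nat \<Rightarrow> nat \<Rightarrow> 'a. \<forall>n. (bad (F n) \<and> mini (F n) n) \<and> (\<forall>i\<le>n. F (Suc n) i = F n i)"
  proof (rule dependent_nat_choice)
    show "\<exists>g. bad g \<and> mini g 0" using ex[OF \<open>bad f0\<close>, of 0] by blast
    show "\<exists>g. (bad g \<and> mini g (Suc n)) \<and> (\<forall>i\<le>n. g i = f i)" if "bad f \<and> mini f n" for f n
      using ex[of f "Suc n"] that by (auto simp: less_Suc_eq_le)
  qed
  then obtain F :: "nat \<Rightarrow> nat \<Rightarrow> 'a" where F: "\<And>n. bad (F n)" "\<And>n. mini (F n) n"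
    "\<And>n i. i \<le> n \<Longrightarrow> F (Suc n) i = F n i" by blast
  have agree: "F n i = F i i" if "i \<le> n" for n i
    using that by (induction n rule: dec_induct) (auto simp: F)
  show thesis
  proof (rule that[of "\<lambda>n. F n n"])
    show "range (\<lambda>n. F n n) \<subseteq> A" using F(1) unfolding bad_def by blast
    show "\<not> r (F i i) (F j j)" if "i < j" for i j
      using F(1)[of j] agree[of i j] that unfolding bad_def by (metis less_imp_le)
    show "m (F n n) \<le> m (g n)"
      if "range g \<subseteq> A" "\<forall>i j. i < j \<longrightarrow> \<not> r (g i) (g j)" "\<forall>i<n. g i = F i i" for g n
    proof -
      have "bad g" using that by (simp add: bad_def)
      moreover have "\<forall>i<n. g i = F n i" using that(3) agree[of _ n] by simp
      ultimately show ?thesis using F(2)[of n] unfolding mini_def by blast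
    qed
  qed
qed

text \<open>For fixed \<open>i\<close> every later index \<open>j\<close> has a witness in the
  finite set \<open>A i\<close>, so one element is a witness for infinitely many \<open>j\<close>.
  Choosing that element and continuing inside those \<open>j\<close> yields a bad sequence of
  elements.\<close>

lemma bad_sequence_of_elements:
  fixes A :: "nat \<Rightarrow> 'a set"
  assumes fin: "\<And>n. finite (A n)" and inf: "infinite N"
    and bad: "\<And>i j. i \<in> N \<Longrightarrow> j \<in> N \<Longrightarrow> i < j \<Longrightarrow> \<exists>a\<in>A i. \<forall>b\<in>A j. \<not> r a b"
  obtains \<nu> a where "strict_mono (\<nu> :: nat \<Rightarrow> nat)" "range \<nu> \<subseteq> N" "\<And>n. a n \<in> A (\<nu> n)"
    "\<And>i j. i < j \<Longrightarrow> \<not> r (a i) (a j)"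
proof -
  \<comment> \<open>\<open>X\<close> is the reservoir from which all later indices are taken;
    \<open>a\<close> is bad against every set indexed by it.\<close>
  define step where "step i a X \<longleftrightarrow> i \<in> N \<and> a \<in> A i \<and> infinite X \<and> X \<subseteq> N \<and>
    (\<forall>j\<in>X. i < j \<and> (\<forall>b\<in>A j. \<not> r a b))" for i :: nat and a X
  have ex: "\<exists>i a Y. step i a Y \<and> i \<in> X \<and> Y \<subseteq> X" if X: "infinite X" "X \<subseteq> N" for X
  proof -
    obtain i where i: "i \<in> X" using X by fastforce
    define Z where "Z = X - {..i}"
    have Z: "infinite Z" using X by (simp add: Z_def Diff_infinite_finite)
    have "\<forall>j\<in>Z. \<exists>a. a \<in> A i \<and> (\<forall>b\<in>A j. \<not> r a b)"
    proof
      fix j assume "j \<in> Z"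
      then have "i \<in> N" "j \<in> N" "i < j" using i X by (auto simp: Z_def)
      then show "\<exists>a. a \<in> A i \<and> (\<forall>b\<in>A j. \<not> r a b)" using bad by blast
    qed
    then obtain c where c: "\<And>j. j \<in> Z \<Longrightarrow> c j \<in> A i \<and> (\<forall>b\<in>A j. \<not> r (c j) b)" by metis
    have "finite (c ` Z)" using c fin[of i] by (meson finite_subset image_subsetI)
    then obtain j0 where "j0 \<in> Z" "infinite {j\<in>Z. c j = c j0}"
      using pigeonhole_infinite[OF Z] by blast
    then have "step i (c j0) {j\<in>Z. c j = c j0}"
      using c i X unfolding step_def by (fastforce simp: Z_def)
    then show ?thesis using i by (fastforce simp: Z_def)
  qed
  have "\<exists>f. \<forall>n. (case f n of (i, a, X) \<Rightarrow> step i a X) \<and>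
      (case (f n, f (Suc n)) of ((i, a, X), (j, b, Y)) \<Rightarrow> j \<in> X \<and> Y \<subseteq> X)"
  proof (rule dependent_nat_choice)
    show "\<exists>x. case x of (i, a, X) \<Rightarrow> step i a X" using ex[OF inf] by auto
    show "\<exists>y. (case y of (i, a, X) \<Rightarrow> step i a X) \<and>
        (case (x, y) of ((i, a, X), (j, b, Y)) \<Rightarrow> j \<in> X \<and> Y \<subseteq> X)"
      if "case x of (i, a, X) \<Rightarrow> step i a X" for x and n :: nat
    proof -
      obtain i a X where x: "x = (i, a, X)" by (cases x)
      then have "infinite X" "X \<subseteq> N" using that by (auto simp: step_def)
      then obtain j b Y where "step j b Y" "j \<in> X" "Y \<subseteq> X" using ex by blast
      then show ?thesis using x by (intro exI[of _ "(j, b, Y)"]) simp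
    qed
  qed
  then obtain f where f: "\<And>n. (case f n of (i, a, X) \<Rightarrow> step i a X) \<and>
      (case (f n, f (Suc n)) of ((i, a, X), (j, b, Y)) \<Rightarrow> j \<in> X \<and> Y \<subseteq> X)" by blast
  define \<nu> a X where "\<nu> n = fst (f n)" and "a n = fst (snd (f n))" and "X n = snd (snd (f n))" for n
  have st: "step (\<nu> n) (a n) (X n)" and next_in: "\<nu> (Suc n) \<in> X n" and sub: "X (Suc n) \<subseteq> X n" for n
    using f[of n] by (auto simp: \<nu>_def a_def X_def split: prod.splits)
  have Xmono: "X j \<subseteq> X i" if "i \<le> j" for i j
    using that by (induction j rule: dec_induct) (use sub in blast)+
  have mem: "\<nu> j \<in> X i" if ij: "i < j" for i j
  proof -
    obtain k where "j = Suc k" "i \<le> k" using ij by (cases j) auto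
    then show ?thesis using next_in[of k] Xmono[of i k] by blast
  qed
  show thesis
  proof
    show "strict_mono \<nu>" using mem st unfolding strict_mono_def step_def by blast
    show "range \<nu> \<subseteq> N" using st unfolding step_def by blast
    show "a n \<in> A (\<nu> n)" for n using st unfolding step_def by blast
    show "\<not> r (a i) (a j)" if "i < j" for i j
      using mem[OF that] st[of i] st[of j] unfolding step_def by blast
  qed
qed

text \<open>Homomorphisms may identify branches, so sets of branches are compared elementwise and no
  analogue of Higman's lemma for sequences is needed.\<close>

lemma kruskal_maps_into:
  fixes \<Lambda> :: "'a set"
  assumes "finite \<Lambda>"
  shows "wqo_on maps_into {T. tree (fst T) \<and> snd T ` fst T \<subseteq> \<Lambda>}"
proof (rule ccontr)
  let ?A = "{T. tree (fst T) \<and> snd T ` fst T \<subseteq> \<Lambda>}"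
  assume "\<not> wqo_on maps_into ?A"
  then obtain f :: "nat \<Rightarrow> nat list set \<times> (nat list \<Rightarrow> 'a)"
    where f: "range f \<subseteq> ?A" "\<And>i j. i < j \<Longrightarrow> \<not> maps_into (f i) (f j)"
    and min: "\<And>g n. range g \<subseteq> ?A \<Longrightarrow> \<forall>i j. i < j \<longrightarrow> \<not> maps_into (g i) (g j) \<Longrightarrow>
      \<forall>i<n. g i = f i \<Longrightarrow> card (fst (f n)) \<le> card (fst (g n))"
    by (rule minimal_bad_sequence[where m = "\<lambda>T. card (fst T)"]) blast
  have tr: "tree (fst (f n))" and lab: "snd (f n) ` fst (f n) \<subseteq> \<Lambda>" for n
    using f(1) by blast+
  have "finite (range (\<lambda>n. snd (f n) []))"
    by (rule finite_subset[OF _ assms]) (use tr lab in \<open>fastforce simp: tree_def\<close>)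
  \<comment> \<open>Once root labels agree, \<open>maps_into_if_branches\<close> turns badness of
    two trees into badness of their sets of branches.\<close>
  then obtain n0 where inf: "infinite {n. snd (f n) [] = snd (f n0) []}"
    using pigeonhole_infinite[of "UNIV :: nat set" "\<lambda>n. snd (f n) []"] by auto
  obtain \<nu> and a :: "nat \<Rightarrow> nat list set \<times> (nat list \<Rightarrow> 'a)"
    where \<nu>: "strict_mono \<nu>" "range \<nu> \<subseteq> {n. snd (f n) [] = snd (f n0) []}"
    and a: "\<And>n. a n \<in> branches (f (\<nu> n))" "\<And>i j. i < j \<Longrightarrow> \<not> maps_into (a i) (a j)"
  proof (rule bad_sequence_of_elements[OF finite_branches inf])
    show "tree (fst (f n))" for n by (rule tr)
    show "\<exists>a\<in>branches (f i). \<forall>b\<in>branches (f j). \<not> maps_into a b"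
      if "i \<in> {n. snd (f n) [] = snd (f n0) []}" "j \<in> {n. snd (f n) [] = snd (f n0) []}" "i < j"
      for i j
      using maps_into_if_branches[OF tr[of i] tr[of j]] f(2)[OF \<open>i < j\<close>] that by auto
  qed blast
  \<comment> \<open>The first \<open>\<nu> 0\<close> trees followed by the bad sequence of branches.
    It is bad since a branch maps into its own tree, and at position \<open>\<nu> 0\<close> it has
    fewer nodes than \<open>f\<close>, against minimality.\<close>
  define g where "g n = (if n < \<nu> 0 then f n else a (n - \<nu> 0))" for n
  have abr: "\<exists>k. [k] \<in> fst (f (\<nu> n)) \<and> a n = branch k (f (\<nu> n))" for n
    using a(1)[of n] by (auto simp: branches_def)
  have aA: "a n \<in> ?A" for n
    using abr[of n] tree_branch[OF tr] snd_branch_image lab by fastforce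
  have "g n \<in> ?A" for n
    using aA[of "n - \<nu> 0"] tr[of n] lab[of n] by (simp add: g_def)
  then have "range g \<subseteq> ?A" by blast
  moreover have "\<not> maps_into (g i) (g j)" if "i < j" for i j
  proof (cases "i < \<nu> 0 \<and> \<not> j < \<nu> 0")
    case True
    have "\<nu> 0 \<le> \<nu> (j - \<nu> 0)" using \<nu>(1) by (simp add: strict_mono_less_eq)
    then have "\<not> maps_into (f i) (f (\<nu> (j - \<nu> 0)))" using True by (intro f(2)) linarith
    then have "\<not> maps_into (f i) (a (j - \<nu> 0))"
      using maps_into_trans[OF _ branches_maps_into[OF a(1)]] by blast
    then show ?thesis
      using True by (simp add: g_def)
  next
    case False
    then show ?thesis using that f(2) a(2) by (auto simp: g_def)
  qed
  ultimately have "card (fst (f (\<nu> 0))) \<le> card (fst (g (\<nu> 0)))"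
    by (intro min) (auto simp: g_def)
  moreover obtain k where "a 0 = branch k (f (\<nu> 0))"
    using abr by blast
  ultimately show False
    using card_branch[OF tr[of "\<nu> 0"], of k] by (simp add: g_def)
qed

section \<open>Maximal ideals of well-quasi-orders\<close>

definition directed :: "('a \<Rightarrow> 'a \<Rightarrow> bool) \<Rightarrow> 'a set \<Rightarrow> bool" where
  "directed r D \<longleftrightarrow> D \<noteq> {} \<and> (\<forall>x\<in>D. \<forall>y\<in>D. \<exists>z\<in>D. r x z \<and> r y z)"

definition down_closed :: "('a \<Rightarrow> 'a \<Rightarrow> bool) \<Rightarrow> 'a set \<Rightarrow> 'a set \<Rightarrow> bool" where
  "down_closed r A X \<longleftrightarrow> X \<subseteq> A \<and> (\<forall>x\<in>A. \<forall>y\<in>X. r x y \<longrightarrow> x \<in> X)"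

definition ideal :: "('a \<Rightarrow> 'a \<Rightarrow> bool) \<Rightarrow> 'a set \<Rightarrow> 'a set \<Rightarrow> bool" where
  "ideal r A I \<longleftrightarrow> down_closed r A I \<and> directed r I"

definition max_ideal :: "('a \<Rightarrow> 'a \<Rightarrow> bool) \<Rightarrow> 'a set \<Rightarrow> 'a set \<Rightarrow> bool" where
  "max_ideal r A I \<longleftrightarrow> ideal r A I \<and> (\<forall>K. ideal r A K \<longrightarrow> I \<subseteq> K \<longrightarrow> K = I)"

lemma max_ideal_eq: "max_ideal r A I \<Longrightarrow> ideal r A K \<Longrightarrow> I \<subseteq> K \<Longrightarrow> K = I"
  by (simp add: max_ideal_def)

lemma max_ideal_ideal: "max_ideal r A I \<Longrightarrow> ideal r A I"
  by (simp add: max_ideal_def)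

lemma ideal_subset: "ideal r A I \<Longrightarrow> I \<subseteq> A"
  by (simp add: ideal_def down_closed_def)

lemma ideal_down: "ideal r A I \<Longrightarrow> y \<in> I \<Longrightarrow> x \<in> A \<Longrightarrow> r x y \<Longrightarrow> x \<in> I"
  unfolding ideal_def down_closed_def by blast

lemma ideal_directed: "ideal r A I \<Longrightarrow> directed r I"
  by (simp add: ideal_def)

lemma directed_bound: "directed r D \<Longrightarrow> x \<in> D \<Longrightarrow> y \<in> D \<Longrightarrow> \<exists>z\<in>D. r x z \<and> r y z"
  by (simp add: directed_def)

lemma directed_times:
  assumes "directed r D" "directed r' D'"
  shows "directed (\<lambda>(a, b) (a', b'). r a a' \<and> r' b b') (D \<times> D')"
  unfolding directed_def
proof (intro conjI ballI)
  show "D \<times> D' \<noteq> {}" using assms by (auto simp: directed_def)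
  fix x y assume "x \<in> D \<times> D'" "y \<in> D \<times> D'"
  then obtain a b c d where eq: "x = (a, b)" "y = (c, d)" "a \<in> D" "b \<in> D'" "c \<in> D" "d \<in> D'"
    by auto
  obtain u where u: "u \<in> D" "r a u" "r c u" using directed_bound[OF assms(1) eq(3,5)] by blast
  obtain v where v: "v \<in> D'" "r' b v" "r' d v" using directed_bound[OF assms(2) eq(4,6)] by blast
  show "\<exists>z\<in>D \<times> D'. (case x of (a, b) \<Rightarrow> \<lambda>(a', b'). r a a' \<and> r' b b') z \<and>
      (case y of (a, b) \<Rightarrow> \<lambda>(a', b'). r a a' \<and> r' b b') z"
    using u v eq by (intro bexI[of _ "(u, v)"]) simp_all
qed

lemma directed_finite_bound:
  assumes D: "directed r D" and trans: "transp r" and "finite F" "\<forall>i\<in>F. d i \<in> D"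
  shows "\<exists>u\<in>D. \<forall>i\<in>F. r (d i) u"
  using assms(3,4)
proof (induction F)
  case empty
  then show ?case using D by (auto simp: directed_def)
next
  case (insert i F)
  then obtain u where "u \<in> D" "\<forall>i\<in>F. r (d i) u" by auto
  moreover obtain z where "z \<in> D" "r u z" "r (d i) z"
    using directed_bound[OF D \<open>u \<in> D\<close>, of "d i"] insert by auto
  ultimately show ?case using transpD[OF trans] by (metis insert_iff)
qed

text \<open>If no \<open>i\<close> occurred cofinally, each \<open>i\<close> would have some
  \<open>d i\<close> above which it never occurs; a common upper bound of these finitely many
  elements could satisfy no \<open>Q\<close>.\<close>

lemma directed_pigeonhole:
  assumes D: "directed r D" and trans: "transp r" and F: "finite F"
    and Q: "\<And>d. d \<in> D \<Longrightarrow> \<exists>i\<in>F. Q d i"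
  shows "\<exists>i\<in>F. \<forall>d\<in>D. \<exists>d'\<in>D. r d d' \<and> Q d' i"
proof (rule ccontr)
  assume "\<not> ?thesis"
  then have "\<forall>i\<in>F. \<exists>d\<in>D. \<forall>d'\<in>D. r d d' \<longrightarrow> \<not> Q d' i" by blast
  then obtain d where d: "\<forall>i\<in>F. d i \<in> D" "\<And>i d'. i \<in> F \<Longrightarrow> d' \<in> D \<Longrightarrow> r (d i) d' \<Longrightarrow> \<not> Q d' i"
    by (metis (no_types))
  obtain u where "u \<in> D" "\<forall>i\<in>F. r (d i) u"
    using directed_finite_bound[OF D trans F d(1)] by blast
  then show False using Q[of u] d(2) by blast
qed

lemma ideal_subset_of_cover:
  assumes I: "ideal r A I" and trans: "transp r" and F: "finite F" "\<And>K. K \<in> F \<Longrightarrow> ideal r A K"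
    and "I \<subseteq> \<Union>F"
  shows "\<exists>K\<in>F. I \<subseteq> K"
proof -
  have "\<exists>K\<in>F. \<forall>d\<in>I. \<exists>d'\<in>I. r d d' \<and> d' \<in> K"
    using ideal_directed[OF I] trans F(1) by (rule directed_pigeonhole) (use assms(5) in blast)
  then obtain K where K: "K \<in> F" "\<forall>d\<in>I. \<exists>d'\<in>I. r d d' \<and> d' \<in> K" by blast
  then have "I \<subseteq> K"
    using ideal_down[OF F(2)[OF K(1)]] ideal_subset[OF I] by blast
  then show ?thesis using K(1) by blast
qed

text \<open>In a strictly descending chain pick \<open>a i\<close> in \<open>f i\<close> but not in
  \<open>f (Suc i)\<close>. A good pair \<open>r (a i) (a j)\<close> would force \<open>a i\<close>
  down into \<open>f j\<close>, hence into \<open>f (Suc i)\<close>.\<close>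

lemma wf_down_closed:
  assumes "wqo_on r A"
  shows "wf {(X, Y). down_closed r A X \<and> down_closed r A Y \<and> X \<subset> Y}"
  unfolding wf_iff_no_infinite_down_chain
proof
  assume "\<exists>f. \<forall>i. (f (Suc i), f i) \<in> {(X, Y). down_closed r A X \<and> down_closed r A Y \<and> X \<subset> Y}"
  then obtain f where "\<forall>i. down_closed r A (f (Suc i)) \<and> down_closed r A (f i) \<and> f (Suc i) \<subset> f i"
    by auto
  then have f: "\<And>i. down_closed r A (f i)" "\<And>i. f (Suc i) \<subset> f i" by blast+
  have "\<exists>a. a \<in> f i \<and> a \<notin> f (Suc i)" for i
    using f(2)[of i] by blast
  then obtain a where a: "\<And>i. a i \<in> f i" "\<And>i. a i \<notin> f (Suc i)" by metis
  have aA: "a i \<in> A" for i using a(1)[of i] f(1)[of i] by (auto simp: down_closed_def)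
  then obtain i j where ij: "i < j" "r (a i) (a j)"
    using assms unfolding wqo_on_def by (metis image_subset_iff)
  have "f j \<subseteq> f (Suc i)"
    using lift_Suc_antimono_le[of f "Suc i" j] f(2) ij(1) by auto
  then have "a i \<in> f (Suc i)"
    using a(1)[of j] f(1)[of "Suc i"] ij(2) aA[of i] by (auto simp: down_closed_def)
  then show False using a(2) by blast
qed

text \<open>Well-founded induction: if \<open>X\<close> is not directed, some \<open>a\<close> and
  \<open>b\<close> have no common upper bound in it, so \<open>X\<close> is the union of its
  elements not above \<open>a\<close> and those not above \<open>b\<close>, both strictly smaller by
  reflexivity.\<close>

lemma down_closed_union_of_ideals:
  assumes "wqo_on r A" and trans: "transp r" and refl: "reflp r"
    and "down_closed r A X"
  shows "\<exists>F. finite F \<and> (\<forall>I\<in>F. ideal r A I) \<and> \<Union>F = X"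
  using assms(4)
proof (induction X rule: wf_induct_rule[OF wf_down_closed[OF assms(1)]])
  case (1 X)
  consider "X = {}" | "directed r X"
    | a b where "a \<in> X" "b \<in> X" "\<And>z. z \<in> X \<Longrightarrow> \<not> (r a z \<and> r b z)"
    unfolding directed_def by blast
  then show ?case
  proof cases
    case 1
    then show ?thesis by (intro exI[of _ "{}"]) simp
  next
    case 2
    then show ?thesis using 1 by (intro exI[of _ "{X}"]) (simp add: ideal_def)
  next
    case 3
    define Y where "Y c = {x\<in>X. \<not> r c x}" for c
    have IH: "\<exists>F. finite F \<and> (\<forall>I\<in>F. ideal r A I) \<and> \<Union>F = Y c" if "c \<in> X" for c
    proof (rule 1)
      show "down_closed r A (Y c)"
        using "1.prems" transpD[OF trans] unfolding down_closed_def Y_def by blast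
      then show "(Y c, X) \<in> {(X, Y). down_closed r A X \<and> down_closed r A Y \<and> X \<subset> Y}"
        using "1.prems" that reflpD[OF refl, of c] by (auto simp: Y_def)
    qed
    obtain F G where "finite F" "\<forall>I\<in>F. ideal r A I" "\<Union>F = Y a"
      "finite G" "\<forall>I\<in>G. ideal r A I" "\<Union>G = Y b"
      using IH[OF 3(1)] IH[OF 3(2)] by blast
    moreover have "X = Y a \<union> Y b"
      using 3(3) by (auto simp: Y_def)
    ultimately show ?thesis
      by (intro exI[of _ "F \<union> G"]) auto
  qed
qed

text \<open>Each maximal ideal lies inside one of the finitely many ideals that cover
  \<open>A\<close>, and so equals it.\<close>

lemma finite_max_ideals:
  assumes "wqo_on r A" "transp r" "reflp r"
  shows "finite {I. max_ideal r A I}"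
proof -
  obtain F where F: "finite F" "\<And>I. I \<in> F \<Longrightarrow> ideal r A I" "\<Union>F = A"
    using down_closed_union_of_ideals[OF assms, of A] by (auto simp: down_closed_def)
  have "I \<in> F" if I: "max_ideal r A I" for I
    using ideal_subset_of_cover[OF max_ideal_ideal[OF I] assms(2) F(1,2)]
      ideal_subset[OF max_ideal_ideal[OF I]] F(2,3) max_ideal_eq[OF I] by metis
  then show ?thesis using F(1) by (auto intro: finite_subset)
qed

text \<open>No choice principle is involved: an inclusion-maximal member of the finite cover is
  already a maximal ideal.\<close>

lemma ideal_extend_max:
  assumes "wqo_on r A" "transp r" "reflp r" "ideal r A I"
  shows "\<exists>K. max_ideal r A K \<and> I \<subseteq> K"
proof -
  obtain F where F: "finite F" "\<And>I. I \<in> F \<Longrightarrow> ideal r A I" "\<Union>F = A"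
    using down_closed_union_of_ideals[OF assms(1-3), of A] by (auto simp: down_closed_def)
  have cov: "\<exists>K\<in>F. J \<subseteq> K" if "ideal r A J" for J
    using ideal_subset_of_cover[OF that assms(2) F(1,2)] ideal_subset[OF that] F(3) by blast
  obtain I' where "I' \<in> F" "I \<subseteq> I'" using cov[OF assms(4)] by blast
  then obtain K where K: "K \<in> F" "I' \<subseteq> K" "\<And>J. J \<in> F \<Longrightarrow> K \<subseteq> J \<Longrightarrow> K = J"
    using finite_has_maximal2[OF F(1)] by metis
  have "max_ideal r A K"
    unfolding max_ideal_def
  proof (intro conjI allI impI)
    show "ideal r A K" using F(2) K(1) by blast
    fix J assume "ideal r A J" "K \<subseteq> J"
    then show "J = K" using cov K(3) by blast
  qed
  then show ?thesis using K(2) \<open>I \<subseteq> I'\<close> by blast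
qed

lemma mem_max_ideal:
  assumes "wqo_on r A" "transp r" "reflp r" "x \<in> A"
  shows "\<exists>K. max_ideal r A K \<and> x \<in> K"
proof -
  have "ideal r A {y\<in>A. r y x}"
    using assms(4) reflpD[OF assms(3)] transpD[OF assms(2)]
    unfolding ideal_def down_closed_def directed_def by blast
  then show ?thesis
    using ideal_extend_max[OF assms(1-3)] assms(4) reflpD[OF assms(3)] by blast
qed

text \<open>The source of the witnesses and confluence squares below. \<open>D\<close> is a directed
  set of demands and \<open>E d a\<close> says that \<open>a\<close> solves \<open>d\<close>.
  Solutions found separately, possibly in unrelated ways, can be collected in one maximal ideal for
  cofinally many demands.\<close>

lemma max_ideal_pigeonhole:
  assumes "directed q D" "transp q" and r: "wqo_on r A" "transp r" "reflp r"
    and E: "\<And>d. d \<in> D \<Longrightarrow> \<exists>a\<in>A. E d a"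
  shows "\<exists>K. max_ideal r A K \<and> (\<forall>d\<in>D. \<exists>d'\<in>D. q d d' \<and> (\<exists>a\<in>K. E d' a))"
proof -
  have "\<exists>K\<in>{K. max_ideal r A K}. \<forall>d\<in>D. \<exists>d'\<in>D. q d d' \<and> (\<exists>a\<in>K. E d' a)"
    by (rule directed_pigeonhole[OF assms(1,2) finite_max_ideals[OF r]])
      (use E mem_max_ideal[OF r] in blast)
  then show ?thesis by blast
qed

section \<open>Finite models from finite quasimodels\<close>

primrec subfms :: "'p fm \<Rightarrow> 'p fm set" where
  "subfms (Var p) = {Var p}"
| "subfms Bot = {Bot}"
| "subfms (Conj A B) = insert (Conj A B) (subfms A \<union> subfms B)"
| "subfms (Disj A B) = insert (Disj A B) (subfms A \<union> subfms B)"
| "subfms (Imp A B) = insert (Imp A B) (subfms A \<union> subfms B)"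
| "subfms (Dia A) = insert (Dia A) (subfms A)"
| "subfms (Box A) = insert (Box A) (subfms A)"

lemma finite_subfms: "finite (subfms A)"
  by (induction A) auto

lemma subfms_refl: "A \<in> subfms A"
  by (cases A) auto

definition subformula_closed :: "'p fm set \<Rightarrow> bool" where
  "subformula_closed \<Sigma> \<longleftrightarrow> (\<forall>A\<in>\<Sigma>. subfms A \<subseteq> \<Sigma>)"

lemma subformula_closedD: "subformula_closed \<Sigma> \<Longrightarrow> A \<in> \<Sigma> \<Longrightarrow> B \<in> subfms A \<Longrightarrow> B \<in> \<Sigma>"
  unfolding subformula_closed_def by blast

lemma subformula_closed_subfms: "subformula_closed (subfms A)"
  unfolding subformula_closed_def by (induction A) auto

lemma forward_confluent_trancl:
  assumes fwd: "forward_confluent L R"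
  shows "forward_confluent L (R\<^sup>+)"
proof -
  have "\<exists>y'. (y, y') \<in> L \<and> (x', y') \<in> R\<^sup>+" if "(x, y) \<in> R\<^sup>+" "(x, x') \<in> L" for x y x'
    using that
  proof (induction rule: trancl_induct)
    case (base y)
    then show ?case using fwd unfolding forward_confluent_def by blast
  next
    case (step y z)
    then obtain y' where "(y, y') \<in> L" "(x', y') \<in> R\<^sup>+" by blast
    moreover obtain z' where "(z, z') \<in> L" "(y', z') \<in> R"
      using fwd step(2) \<open>(y, y') \<in> L\<close> unfolding forward_confluent_def by blast
    ultimately show ?case by (meson trancl.trancl_into_trancl)
  qed
  then show ?thesis unfolding forward_confluent_def by blast
qed

lemma backward_confluent_trancl:
  assumes bwd: "backward_confluent L R"
  shows "backward_confluent L (R\<^sup>+)"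
proof -
  have "\<exists>x'. (x, x') \<in> L \<and> (x', y') \<in> R\<^sup>+" if "(x, y) \<in> R\<^sup>+" "(y, y') \<in> L" for x y y'
    using that
  proof (induction arbitrary: y' rule: trancl_induct)
    case (base y)
    then show ?case using bwd unfolding backward_confluent_def by blast
  next
    case (step y z)
    then obtain y1 where "(y, y1) \<in> L" "(y1, y') \<in> R"
      using bwd unfolding backward_confluent_def by blast
    moreover obtain x' where "(x, x') \<in> L" "(x', y1) \<in> R\<^sup>+"
      using step.IH \<open>(y, y1) \<in> L\<close> by blast
    ultimately show ?case by (meson trancl.trancl_into_trancl)
  qed
  then show ?thesis unfolding backward_confluent_def by blast
qed

text \<open>\<open>L\<close> is only a preorder and \<open>R\<close> need not be transitive. To make
  up for the latter, \<open>t_Box\<close> and \<open>t_Dia\<close> also transmit the modal formula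
  itself, so that they can be iterated along \<open>R\<close>-paths.\<close>

locale quasimodel =
  fixes W :: "'a set" and L R :: "'a rel" and t :: "'a \<Rightarrow> 'p fm set" and \<Sigma> :: "'p fm set"
  assumes finite_W: "finite W" and L_W: "L \<subseteq> W \<times> W" and R_W: "R \<subseteq> W \<times> W"
    and refl_L: "\<And>x. x \<in> W \<Longrightarrow> (x, x) \<in> L" and trans_L: "trans L"
    and fwd: "forward_confluent L R" and bwd: "backward_confluent L R"
    and mono: "\<And>x y. (x, y) \<in> L \<Longrightarrow> t x \<subseteq> t y"
    and closed: "subformula_closed \<Sigma>"
    and t_Bot: "\<And>x. x \<in> W \<Longrightarrow> Bot \<notin> t x"
    and t_Conj: "\<And>x A B. x \<in> W \<Longrightarrow> Conj A B \<in> \<Sigma> \<Longrightarrow> Conj A B \<in> t x \<longleftrightarrow> A \<in> t x \<and> B \<in> t x"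
    and t_Disj: "\<And>x A B. x \<in> W \<Longrightarrow> Disj A B \<in> \<Sigma> \<Longrightarrow> Disj A B \<in> t x \<longleftrightarrow> A \<in> t x \<or> B \<in> t x"
    and t_mp: "\<And>x A B. x \<in> W \<Longrightarrow> Imp A B \<in> t x \<Longrightarrow> A \<in> t x \<Longrightarrow> Imp A B \<in> \<Sigma> \<Longrightarrow> B \<in> t x"
    and t_Imp: "\<And>x A B. x \<in> W \<Longrightarrow> Imp A B \<in> \<Sigma> \<Longrightarrow> Imp A B \<notin> t x \<Longrightarrow>
      \<exists>y. (x, y) \<in> L \<and> A \<in> t y \<and> B \<notin> t y"
    and t_Box: "\<And>x y A. (x, y) \<in> R \<Longrightarrow> Box A \<in> \<Sigma> \<Longrightarrow> Box A \<in> t x \<Longrightarrow> A \<in> t y \<and> Box A \<in> t y"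
    and t_Dia: "\<And>x y A. (x, y) \<in> R \<Longrightarrow> Dia A \<in> \<Sigma> \<Longrightarrow> A \<in> t y \<or> Dia A \<in> t y \<Longrightarrow> Dia A \<in> t x"
    and t_Box_witness: "\<And>x A. x \<in> W \<Longrightarrow> Box A \<in> \<Sigma> \<Longrightarrow> Box A \<notin> t x \<Longrightarrow>
      \<exists>u v. (x, u) \<in> L \<and> (u, v) \<in> R \<and> A \<notin> t v"
    and t_Dia_witness: "\<And>x A. x \<in> W \<Longrightarrow> Dia A \<in> \<Sigma> \<Longrightarrow> Dia A \<in> t x \<Longrightarrow>
      \<exists>y. (x, y) \<in> R \<and> A \<in> t y"
begin

lemma finite_model:
  "\<exists>M :: (nat, 'p) model. int_trans_model M \<and> finite (worlds M) \<and>
    (\<forall>x\<in>W. \<exists>w\<in>worlds M. \<forall>A\<in>\<Sigma>. holds M A w \<longleftrightarrow> A \<in> t x)"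
proof -
  \<comment> \<open>Points of a preorder are equivalent exactly if they have the same up-set, so
    numbering the finitely many up-sets realizes the quotient on natural numbers.\<close>
  obtain f :: "'a set \<Rightarrow> nat" where f: "inj_on f ((\<lambda>x. L `` {x}) ` W)"
    using finite_imp_inj_to_nat_seg[of "(\<lambda>x. L `` {x}) ` W"] finite_W by blast
  define e where "e x = f (L `` {x})" for x
  have e_eq: "(x, y) \<in> L" if "e x = e y" "x \<in> W" "y \<in> W" for x y
  proof -
    have "L `` {x} = L `` {y}"
      using that f unfolding e_def by (auto dest: inj_onD)
    then show ?thesis using refl_L[OF that(3)] by blast
  qed
  define L' where "L' = {(e x, e y) |x y. (x, y) \<in> L}"
  define R' where "R' = {(e x, e y) |x y. (x, y) \<in> R}"
  define M :: "(nat, 'p) model" where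
    "M = \<lparr>worlds = e ` W, le = L', acc = R'\<^sup>+, val = \<lambda>p. {e x |x. x \<in> W \<and> Var p \<in> t x}\<rparr>"
  have L': "(e x, e y) \<in> L' \<longleftrightarrow> (x, y) \<in> L" if "x \<in> W" "y \<in> W" for x y
  proof
    assume "(e x, e y) \<in> L'"
    then obtain x' y' where xy: "(x', y') \<in> L" "e x = e x'" "e y = e y'"
      by (auto simp: L'_def)
    moreover have "x' \<in> W" "y' \<in> W" using xy L_W by auto
    ultimately have "(x, x') \<in> L" "(y', y) \<in> L" using e_eq that by metis+
    then show "(x, y) \<in> L" using xy(1) trans_L by (meson transD)
  qed (auto simp: L'_def)
  \<comment> \<open>\<open>L\<close> holds for all representatives or for none, whereas
    \<open>R\<close> may hold for some only. The confluence proofs therefore fix representatives of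
    the \<open>R\<close>-step and let the \<open>L\<close>-step start at them.\<close>
  have L'_obtain: "\<exists>y\<in>W. b = e y \<and> (x, y) \<in> L" if b: "(e x, b) \<in> L'" "x \<in> W" for x b
  proof -
    obtain y where "b = e y" "y \<in> W" using b(1) L_W by (auto simp: L'_def)
    then show ?thesis using L' b by blast
  qed
  have t_e: "t x = t y" if "e x = e y" "x \<in> W" "y \<in> W" for x y
    using e_eq[of x y] e_eq[of y x] that mono by (metis subset_antisym)
  have "antisym L'"
  proof (rule antisymI)
    fix a b assume ab: "(a, b) \<in> L'" "(b, a) \<in> L'"
    then obtain x y where x: "a = e x" "b = e y" "x \<in> W" "y \<in> W"
      using L_W by (auto simp: L'_def)
    then have "(x, y) \<in> L" "(y, x) \<in> L" using ab L' by auto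
    then have "L `` {x} = L `` {y}" using trans_L by (auto dest: transD)
    then show "a = b" using x by (simp add: e_def)
  qed
  moreover have "trans L'"
  proof (rule transI)
    fix a b c assume abc: "(a, b) \<in> L'" "(b, c) \<in> L'"
    then obtain x y z where x: "a = e x" "b = e y" "c = e z" "x \<in> W" "y \<in> W" "z \<in> W"
      using L_W by (auto simp: L'_def)
    then have "(x, y) \<in> L" "(y, z) \<in> L" using abc L' by auto
    then show "(a, c) \<in> L'" using x L' trans_L by (auto dest: transD)
  qed
  moreover have "refl_on (e ` W) L'"
    using refl_L by (auto simp: refl_on_def L'_def)
  moreover have "L' \<subseteq> e ` W \<times> e ` W" using L_W by (auto simp: L'_def)
  ultimately have po: "partial_order_on (e ` W) L'"
    by (simp add: partial_order_on_def preorder_on_def)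
  have R'_W: "R' \<subseteq> e ` W \<times> e ` W" using R_W by (auto simp: R'_def)
  have "forward_confluent L' R'"
    unfolding forward_confluent_def
  proof (intro allI impI, elim conjE)
    fix a a' b assume "(a, b) \<in> R'" "(a, a') \<in> L'"
    then obtain x y where x: "a = e x" "b = e y" "(x, y) \<in> R" "x \<in> W" "y \<in> W"
      using R_W by (auto simp: R'_def)
    then obtain x' where "a' = e x'" "(x, x') \<in> L"
      using L'_obtain \<open>(a, a') \<in> L'\<close> by blast
    moreover obtain y' where "(y, y') \<in> L" "(x', y') \<in> R"
      using fwd x(3) \<open>(x, x') \<in> L\<close> unfolding forward_confluent_def by blast
    ultimately show "\<exists>b'. (b, b') \<in> L' \<and> (a', b') \<in> R'"
      using x by (auto simp: L'_def R'_def)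
  qed
  moreover have "backward_confluent L' R'"
    unfolding backward_confluent_def
  proof (intro allI impI, elim conjE)
    fix a b b' assume "(a, b) \<in> R'" "(b, b') \<in> L'"
    then obtain x y where x: "a = e x" "b = e y" "(x, y) \<in> R" "x \<in> W" "y \<in> W"
      using R_W by (auto simp: R'_def)
    then obtain y' where "b' = e y'" "(y, y') \<in> L"
      using L'_obtain \<open>(b, b') \<in> L'\<close> by blast
    moreover obtain x' where "(x, x') \<in> L" "(x', y') \<in> R"
      using bwd x(3) \<open>(y, y') \<in> L\<close> unfolding backward_confluent_def by blast
    ultimately show "\<exists>a'. (a, a') \<in> L' \<and> (a', b') \<in> R'"
      using x by (auto simp: L'_def R'_def)
  qed
  moreover have "\<forall>p w v. w \<in> val M p \<and> (w, v) \<in> L' \<longrightarrow> v \<in> val M p"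
    using L'_obtain mono by (fastforce simp: M_def)
  moreover have "R'\<^sup>+ \<subseteq> e ` W \<times> e ` W"
    using R'_W by (rule trancl_subset_Sigma)
  ultimately have model: "int_trans_model M"
    unfolding int_trans_model_def
    by (intro conjI) (auto simp: M_def po forward_confluent_trancl backward_confluent_trancl)
  \<comment> \<open>Types are constant on classes, so the two ends of consecutive
    \<open>R\<close>-steps can be glued although their representatives differ.\<close>
  have acc_t: "(Dia A \<in> \<Sigma> \<longrightarrow> A \<in> t y \<or> Dia A \<in> t y \<longrightarrow> Dia A \<in> t x) \<and>
      (Box A \<in> \<Sigma> \<longrightarrow> Box A \<in> t x \<longrightarrow> A \<in> t y \<and> Box A \<in> t y)"
    if "(a, b) \<in> R'\<^sup>+" "a = e x" "b = e y" "x \<in> W" "y \<in> W" for a b x y A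
    using that
  proof (induction arbitrary: y rule: trancl_induct)
    case (base b)
    then obtain x' y' where xy: "e x = e x'" "e y = e y'" "(x', y') \<in> R"
      by (auto simp: R'_def)
    then have "t x = t x'" "t y = t y'" using t_e base R_W by auto
    then show ?case using xy t_Dia t_Box by blast
  next
    case (step b c)
    then obtain y' z' where xy: "b = e y'" "e y = e z'" "(y', z') \<in> R" "y' \<in> W" "z' \<in> W"
      using R_W by (auto simp: R'_def)
    have "t y = t z'" by (rule t_e[OF xy(2) step.prems(4) xy(5)])
    moreover have "(Dia A \<in> \<Sigma> \<longrightarrow> A \<in> t y' \<or> Dia A \<in> t y' \<longrightarrow> Dia A \<in> t x) \<and>
      (Box A \<in> \<Sigma> \<longrightarrow> Box A \<in> t x \<longrightarrow> A \<in> t y' \<and> Box A \<in> t y')"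
      using xy(1,4) step.prems by (intro step.IH)
    ultimately show ?case using t_Dia[OF xy(3), of A] t_Box[OF xy(3), of A] by simp
  qed
  have "A \<in> \<Sigma> \<longrightarrow> x \<in> W \<longrightarrow> (holds M A (e x) \<longleftrightarrow> A \<in> t x)" for A x
  proof (induction A arbitrary: x)
    case (Var p)
    show ?case
    proof (intro impI)
      assume "x \<in> W"
      then show "holds M (Var p) (e x) \<longleftrightarrow> Var p \<in> t x"
      proof -
        have "holds M (Var p) (e x) \<longleftrightarrow> (\<exists>y. e x = e y \<and> y \<in> W \<and> Var p \<in> t y)"
          by (simp add: M_def)
        also have "\<dots> \<longleftrightarrow> Var p \<in> t x"
          using t_e \<open>x \<in> W\<close> by metis
        finally show ?thesis .
      qed
    qed
  next
    case Bot
    then show ?case using t_Bot by simp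
  next
    case (Conj A B)
    show ?case
    proof (intro impI)
      assume \<Sigma>: "Conj A B \<in> \<Sigma>" and x: "x \<in> W"
      have "A \<in> \<Sigma>" "B \<in> \<Sigma>"
        by (auto intro: subformula_closedD[OF closed \<Sigma>] simp: subfms_refl)
      then show "holds M (Conj A B) (e x) \<longleftrightarrow> Conj A B \<in> t x"
        using Conj t_Conj[OF x \<Sigma>] x by simp
    qed
  next
    case (Disj A B)
    show ?case
    proof (intro impI)
      assume \<Sigma>: "Disj A B \<in> \<Sigma>" and x: "x \<in> W"
      have "A \<in> \<Sigma>" "B \<in> \<Sigma>"
        by (auto intro: subformula_closedD[OF closed \<Sigma>] simp: subfms_refl)
      then show "holds M (Disj A B) (e x) \<longleftrightarrow> Disj A B \<in> t x"
        using Disj t_Disj[OF x \<Sigma>] x by simp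
    qed
  next
    case (Imp A B)
    show ?case
    proof (intro impI)
      assume \<Sigma>: "Imp A B \<in> \<Sigma>" and x: "x \<in> W"
      have AB: "A \<in> \<Sigma>" "B \<in> \<Sigma>"
        by (auto intro: subformula_closedD[OF closed \<Sigma>] simp: subfms_refl)
      have "holds M (Imp A B) (e x) \<longleftrightarrow> (\<forall>y. (x, y) \<in> L \<longrightarrow> A \<in> t y \<longrightarrow> B \<in> t y)"
      proof
        assume h: "holds M (Imp A B) (e x)"
        show "\<forall>y. (x, y) \<in> L \<longrightarrow> A \<in> t y \<longrightarrow> B \<in> t y"
        proof (intro allI impI)
          fix y assume "(x, y) \<in> L" "A \<in> t y"
          moreover have "y \<in> W" "(e x, e y) \<in> L'" using \<open>(x, y) \<in> L\<close> L_W by (auto simp: L'_def)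
          ultimately show "B \<in> t y" using h Imp AB by (auto simp: M_def)
        qed
      next
        assume h: "\<forall>y. (x, y) \<in> L \<longrightarrow> A \<in> t y \<longrightarrow> B \<in> t y"
        show "holds M (Imp A B) (e x)"
        proof (unfold holds.simps, intro allI impI)
          fix b assume "(e x, b) \<in> le M"
          then obtain y where "y \<in> W" "b = e y" "(x, y) \<in> L"
            using L'_obtain x by (auto simp: M_def)
          then show "\<not> holds M A b \<or> holds M B b" using h Imp AB by blast
        qed
      qed
      then show "holds M (Imp A B) (e x) \<longleftrightarrow> Imp A B \<in> t x"
        using t_Imp[OF x \<Sigma>] t_mp[OF _ _ _ \<Sigma>] mono[of x] L_W by blast
    qed
  next
    case (Dia A)
    show ?case
    proof (intro impI)
      assume \<Sigma>: "Dia A \<in> \<Sigma>" and x: "x \<in> W"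
      have A: "A \<in> \<Sigma>"
        by (auto intro: subformula_closedD[OF closed \<Sigma>] simp: subfms_refl)
      show "holds M (Dia A) (e x) \<longleftrightarrow> Dia A \<in> t x"
      proof
        assume "holds M (Dia A) (e x)"
        then obtain b where b: "(e x, b) \<in> R'\<^sup>+" "holds M A b" by (auto simp: M_def)
        then obtain y where "y \<in> W" "b = e y" using \<open>R'\<^sup>+ \<subseteq> e ` W \<times> e ` W\<close> by blast
        then show "Dia A \<in> t x" using acc_t[OF b(1)] Dia A \<Sigma> b(2) x by blast
      next
        assume "Dia A \<in> t x"
        then obtain y where y: "(x, y) \<in> R" "A \<in> t y" using t_Dia_witness x \<Sigma> by blast
        moreover have "y \<in> W" using y R_W by auto
        ultimately have "(e x, e y) \<in> R'\<^sup>+" "holds M A (e y)"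
          using Dia A by (auto simp: R'_def)
        then show "holds M (Dia A) (e x)" by (auto simp: M_def)
      qed
    qed
  next
    case (Box A)
    show ?case
    proof (intro impI)
      assume \<Sigma>: "Box A \<in> \<Sigma>" and x: "x \<in> W"
      have A: "A \<in> \<Sigma>"
        by (auto intro: subformula_closedD[OF closed \<Sigma>] simp: subfms_refl)
      show "holds M (Box A) (e x) \<longleftrightarrow> Box A \<in> t x"
      proof
        assume h: "holds M (Box A) (e x)"
        show "Box A \<in> t x"
        proof (rule ccontr)
          assume "Box A \<notin> t x"
          then obtain u v where uv: "(x, u) \<in> L" "(u, v) \<in> R" "A \<notin> t v"
            using t_Box_witness x \<Sigma> by blast
          then have "(e x, e u) \<in> L'" "(e u, e v) \<in> R'\<^sup>+" by (auto simp: L'_def R'_def)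
          then have "holds M A (e v)" using h by (auto simp: M_def)
          moreover have "v \<in> W" using uv R_W by auto
          ultimately show False using Box A uv(3) by blast
        qed
      next
        assume h: "Box A \<in> t x"
        show "holds M (Box A) (e x)"
        proof (unfold holds.simps, intro allI impI, elim conjE)
          fix a b assume "(e x, a) \<in> le M" "(a, b) \<in> acc M"
          then have ab: "(e x, a) \<in> L'" "(a, b) \<in> R'\<^sup>+" by (simp_all add: M_def)
          then obtain u where u: "u \<in> W" "a = e u" "(x, u) \<in> L"
            using L'_obtain x by blast
          moreover obtain v where v: "v \<in> W" "b = e v"
            using ab(2) \<open>R'\<^sup>+ \<subseteq> e ` W \<times> e ` W\<close> by blast
          moreover have "Box A \<in> t u" using h u(3) mono by blast
          ultimately have "A \<in> t v" using acc_t[OF ab(2)] \<Sigma> by blast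
          then show "holds M A b" using Box A v by blast
        qed
      qed
    qed
  qed
  then show ?thesis
    using model finite_W by (intro exI[of _ M]) (auto simp: M_def)
qed

end

section \<open>Pointed trees realized in the canonical model\<close>

text \<open>The distinguished nodes form a list, so that one order and one well-quasi-order proof
  serve trees with one point and trees with two.\<close>

type_synonym 'l pattern = "nat list set \<times> (nat list \<Rightarrow> 'l) \<times> nat list list"

definition pattern_le :: "'l pattern \<Rightarrow> 'l pattern \<Rightarrow> bool" where
  "pattern_le = (\<lambda>(S, lab, xs) (S', lab', xs').
    \<exists>h. tree_hom h (S, lab) (S', lab') \<and> map h xs = xs')"

lemma pattern_le_iff: "pattern_le (S, lab, xs) (S', lab', xs') \<longleftrightarrow>
    (\<exists>h. tree_hom h (S, lab) (S', lab') \<and> map h xs = xs')"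
  by (simp add: pattern_le_def)

lemma reflp_pattern_le: "reflp pattern_le"
proof (rule reflpI)
  fix P :: "'a pattern"
  obtain S lab xs where "P = (S, lab, xs)" by (cases P)
  then show "pattern_le P P"
    using tree_hom_id by (auto simp: pattern_le_iff intro!: exI[of _ id])
qed

lemma transp_pattern_le: "transp pattern_le"
proof (rule transpI)
  fix P Q U :: "'a pattern"
  assume PQ: "pattern_le P Q" "pattern_le Q U"
  obtain S lab xs S' lab' xs' S'' lab'' xs''
    where eq: "P = (S, lab, xs)" "Q = (S', lab', xs')" "U = (S'', lab'', xs'')"
    by (cases P, cases Q, cases U)
  then obtain h h' where "tree_hom h (S, lab) (S', lab')" "map h xs = xs'"
    "tree_hom h' (S', lab') (S'', lab'')" "map h' xs' = xs''"
    using PQ by (auto simp: pattern_le_iff)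
  then have "tree_hom (h' \<circ> h) (S, lab) (S'', lab'')" "map (h' \<circ> h) xs = xs''"
    using tree_hom_comp by auto
  then show "pattern_le P U" using eq pattern_le_iff by blast
qed

lemmas pattern_le_refl = reflpD[OF reflp_pattern_le]
lemmas pattern_le_trans = transpD[OF transp_pattern_le]

lemma pattern_le_point:
  "pattern_le (S, lab, xs) (S', lab', xs') \<Longrightarrow> i < length xs \<Longrightarrow>
    pattern_le (S, lab, [xs ! i]) (S', lab', [xs' ! i])"
  by (auto simp: pattern_le_iff)

lemma wqo_pattern_le:
  assumes "finite \<Lambda>"
  shows "wqo_on pattern_le {(S, lab, xs). tree S \<and> lab ` S \<subseteq> \<Lambda> \<and> set xs \<subseteq> S \<and> length xs = n}"
    (is "wqo_on _ ?A")
  unfolding wqo_on_def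
proof (intro allI impI)
  fix f :: "nat \<Rightarrow> 'a pattern"
  assume f: "range f \<subseteq> ?A"
  define S lab xs where "S i = fst (f i)" and "lab i = fst (snd (f i))" and "xs i = snd (snd (f i))"
    for i
  have fi: "f i = (S i, lab i, xs i)" for i by (simp add: S_def lab_def xs_def)
  have A: "tree (S i)" "lab i ` S i \<subseteq> \<Lambda>" "set (xs i) \<subseteq> S i" "length (xs i) = n" for i
  proof -
    have "f i \<in> ?A" by (rule subsetD[OF f rangeI])
    then show "tree (S i)" "lab i ` S i \<subseteq> \<Lambda>" "set (xs i) \<subseteq> S i" "length (xs i) = n"
      unfolding fi by simp_all
  qed
  \<comment> \<open>The distinguished points become part of the labels.\<close>
  define T where "T i = (S i, \<lambda>p. (lab i p, map (\<lambda>x. x = p) (xs i)))" for i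
  let ?\<Lambda> = "\<Lambda> \<times> {bs. set bs \<subseteq> (UNIV :: bool set) \<and> length bs = n}"
  have "finite ?\<Lambda>"
    using assms finite_lists_length_eq[of "UNIV :: bool set" n] by simp
  moreover have "range T \<subseteq> {T. tree (fst T) \<and> snd T ` fst T \<subseteq> ?\<Lambda>}"
    using A(1,4) subsetD[OF A(2) imageI] by (auto simp: T_def)
  ultimately obtain i j h where ij: "i < j" "tree_hom h (T i) (T j)"
    using kruskal_maps_into[of ?\<Lambda>] unfolding wqo_on_def maps_into_def by meson
  have "map h (xs i) = xs j"
  proof (rule nth_equalityI)
    fix m assume m: "m < length (map h (xs i))"
    then have "xs i ! m \<in> S i" by (intro subsetD[OF A(3)] nth_mem) simp
    \<comment> \<open>Labels are preserved, so the bit vector of the \<open>m\<close>-th point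
      reappears at its image. Its \<open>m\<close>-th bit is true, which says that the image is the
      \<open>m\<close>-th point of the target.\<close>
    then have "map (\<lambda>x. x = h (xs i ! m)) (xs j) = map (\<lambda>x. x = xs i ! m) (xs i)"
      using ij(2) by (auto simp: tree_hom_def T_def)
    then have "map (\<lambda>x. x = h (xs i ! m)) (xs j) ! m = map (\<lambda>x. x = xs i ! m) (xs i) ! m"
      by simp
    then show "map h (xs i) ! m = xs j ! m" using m A(4) by simp
  qed (simp add: A)
  moreover have "tree_hom h (S i, lab i) (S j, lab j)"
    using ij(2) by (auto simp: tree_hom_def T_def)
  ultimately show "\<exists>i j. i < j \<and> pattern_le (f i) (f j)"
    using ij(1) fi pattern_le_iff by metis
qed

section \<open>Realizations of trees by prime theories\<close>

context infinite_atoms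
begin

definition realizes :: "(nat list \<Rightarrow> 'p fm set) \<Rightarrow> nat list set \<Rightarrow> bool" where
  "realizes g S \<longleftrightarrow> (\<forall>p\<in>S. prime (g p)) \<and> (\<forall>p k. p @ [k] \<in> S \<longrightarrow> can_acc (g p) (g (p @ [k])))"

lemma realizes_can_acc:
  assumes "tree S" "realizes g S" "q \<in> S" "strict_prefix p q"
  shows "p \<in> S \<and> can_acc (g p) (g q)"
  using assms(3,4)
proof (induction q rule: rev_induct)
  case Nil
  then show ?case by simp
next
  case (snoc k q)
  have q: "q \<in> S" using assms(1) snoc.prems(1) unfolding tree_def by blast
  have acc: "can_acc (g q) (g (q @ [k]))" using assms(2) snoc.prems(1) by (simp add: realizes_def)
  have "prefix p q" using snoc.prems(2) by (auto simp: strict_prefix_def)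
  show ?case
  proof (cases "p = q")
    case True
    then show ?thesis using q acc by simp
  next
    case False
    then have "p \<in> S \<and> can_acc (g p) (g q)"
      using snoc.IH q \<open>prefix p q\<close> by (simp add: strict_prefix_def)
    moreover have "prime (g p)" using calculation assms(2) by (simp add: realizes_def)
    ultimately show ?thesis using can_acc_trans acc by blast
  qed
qed

text \<open>A child step may be stretched to a path; \<open>realizes_can_acc\<close> shortens it
  again by transitivity of \<open>can_acc\<close>.\<close>

lemma realizes_hom:
  assumes "tree S" "tree S'" "realizes g S'" "tree_hom h (S, lab) (S', lab')"
  shows "realizes (g \<circ> h) S"
  unfolding realizes_def
proof (intro conjI ballI allI impI)
  show "prime ((g \<circ> h) p)" if "p \<in> S" for p
    using that assms(3,4) by (simp add: realizes_def tree_hom_def)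
  show "can_acc ((g \<circ> h) p) ((g \<circ> h) (p @ [k]))" if pk: "p @ [k] \<in> S" for p k
  proof -
    have "p \<in> S" using assms(1) pk unfolding tree_def by blast
    then have "strict_prefix (h p) (h (p @ [k]))" "h (p @ [k]) \<in> S'"
      using assms(4) pk by (auto simp: tree_hom_def strict_prefix_def)
    then show ?thesis using realizes_can_acc[OF assms(2,3)] by simp
  qed
qed

text \<open>Induction by removing a leaf. If the leaf itself is to be raised, backward confluence
  says how far to raise its parent, and the induction hypothesis does that in the rest. Otherwise
  the rest is raised first and the leaf is adjusted to its parent by forward confluence.\<close>

lemma realizes_raise:
  assumes "tree S" "realizes g S" "x \<in> S" "prime w" "g x \<subseteq> w"
  shows "\<exists>g'. realizes g' S \<and> (\<forall>p\<in>S. g p \<subseteq> g' p) \<and> g' x = w"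
  using assms
proof (induction "card S" arbitrary: S x w rule: less_induct)
  case less
  show ?case
  proof (cases "S = {[]}")
    case True
    then show ?thesis
      using less.prems by (intro exI[of _ "\<lambda>_. w"]) (auto simp: realizes_def)
  next
    case False
    then obtain q k where qk: "q @ [k] \<in> S" "tree (S - {q @ [k]})"
      and leaf: "\<And>j. q @ [k] @ [j] \<notin> S"
      using tree_leaf[OF less.prems(1)] by metis
    let ?S = "S - {q @ [k]}"
    have card: "card ?S < card S"
      using qk(1) less.prems(1) by (intro psubset_card_mono) (auto simp: tree_def)
    have re: "realizes g ?S" using less.prems(2) by (auto simp: realizes_def)
    have q: "q \<in> ?S" using qk(1) less.prems(1) by (auto simp: tree_def)
    have prime_q: "prime (g q)" and prime_qk: "prime (g (q @ [k]))"
      and acc: "can_acc (g q) (g (q @ [k]))"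
      using less.prems(2) q qk(1) by (auto simp: realizes_def)
    have extend: "realizes (g'(q @ [k] := v)) S"
      if "realizes g' ?S" "prime v" "can_acc (g' q) v" for g' v
    proof -
      have "p \<noteq> q @ [k]" if "p @ [j] \<in> S" for p j
        using that leaf[of j] by auto
      then show ?thesis
        using that unfolding realizes_def by auto
    qed
    show ?thesis
    proof (cases "x = q @ [k]")
      case True
      obtain u where u: "prime u" "g q \<subseteq> u" "can_acc u w"
        using can_backward[OF prime_q less.prems(4)] acc less.prems(5) True
        unfolding can_acc_def by blast
      then obtain g' where g': "realizes g' ?S" "\<forall>p\<in>?S. g p \<subseteq> g' p" "g' q = u"
        using less.hyps[OF card qk(2) re q] by blast
      then have "realizes (g'(q @ [k] := w)) S" using extend less.prems(4) u(3) by simp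
      then show ?thesis
        using g'(2) less.prems(5) True by (intro exI[of _ "g'(q @ [k] := w)"]) auto
    next
      case False
      then obtain g' where g': "realizes g' ?S" "\<forall>p\<in>?S. g p \<subseteq> g' p" "g' x = w"
        using less.hyps[OF card qk(2) re, of x w] less.prems by blast
      have "prime (g' q)" using g'(1) q by (simp add: realizes_def)
      then obtain v where "prime v" "g (q @ [k]) \<subseteq> v" "can_acc (g' q) v"
        using can_forward[OF prime_q _ prime_qk acc, of "g' q"] g'(2) q by blast
      then show ?thesis
        using extend[OF g'(1)] g' False by (intro exI[of _ "g'(q @ [k] := v)"]) auto
    qed
  qed
qed

lemma realizes_new_child:
  assumes "tree S" "realizes g S" "x \<in> S" "prime v" "can_acc (g x) v"
  obtains S' g' y where "tree S'" "S \<subseteq> S'" "y \<in> S'" "strict_prefix x y" "realizes g' S'"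
    "\<And>p. p \<in> S \<Longrightarrow> g' p = g p" "g' y = v"
proof -
  have fin: "finite S" using assms(1) by (simp add: tree_def)
  have "finite ((\<lambda>k. x @ [k]) -` S)"
    using fin by (intro finite_vimageI) (auto simp: inj_def)
  then obtain k where k: "x @ [k] \<notin> S"
    using ex_new_if_finite[of "(\<lambda>k. x @ [k]) -` S"] by auto
  let ?y = "x @ [k]"
  have no: "p \<noteq> ?y" if "p @ [j] \<in> S" for p j
    using that k assms(1) by (auto simp: tree_def)
  show thesis
  proof (rule that[of "insert ?y S" ?y "g(?y := v)"])
    show "tree (insert ?y S)" using assms(1,3) by (auto simp: tree_def)
    show "realizes (g(?y := v)) (insert ?y S)"
      unfolding realizes_def
    proof (intro conjI ballI allI impI)
      show "prime ((g(?y := v)) p)" if "p \<in> insert ?y S" for p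
        using that assms(2,4) by (auto simp: realizes_def)
      show "can_acc ((g(?y := v)) p) ((g(?y := v)) (p @ [j]))" if "p @ [j] \<in> insert ?y S" for p j
        using that assms(2,5) no[of p j] k by (auto simp: realizes_def)
    qed
  qed (use k in \<open>auto simp: strict_prefix_def\<close>)
qed

end

section \<open>Ideals of realizable pointed trees and the relations between them\<close>

locale ik4_patterns = infinite_atoms atoms for atoms :: "'p set" +
  fixes \<Sigma> :: "'p fm set"
  assumes finite_\<Sigma>: "finite \<Sigma>"
begin

definition realizable :: "nat list set \<Rightarrow> (nat list \<Rightarrow> 'p fm set) \<Rightarrow> bool" where
  "realizable S lab \<longleftrightarrow> tree S \<and> (\<exists>g. realizes g S \<and> (\<forall>p\<in>S. lab p = g p \<inter> \<Sigma>))"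

lemma realizable_tree: "realizable S lab \<Longrightarrow> tree S"
  by (simp add: realizable_def)

lemma realizable_hom:
  assumes "realizable S' lab'" "tree S" "tree_hom h (S, lab) (S', lab')"
  shows "realizable S lab"
proof -
  obtain g where g: "tree S'" "realizes g S'" "\<forall>p\<in>S'. lab' p = g p \<inter> \<Sigma>"
    using assms(1) by (auto simp: realizable_def)
  have "lab p = (g \<circ> h) p \<inter> \<Sigma>" if "p \<in> S" for p
    using that g(3) assms(3) by (auto simp: tree_hom_def)
  then show ?thesis
    using realizes_hom[OF assms(2) g(1,2) assms(3)] assms(2) unfolding realizable_def by blast
qed

definition pts1 :: "'p fm set pattern set" where
  "pts1 = {(S, lab, [x]) |S lab x. realizable S lab \<and> x \<in> S}"

text \<open>Comparable nodes rather than parent and child, because comparability is what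
  homomorphisms preserve; \<open>pts2_hom\<close> depends on it.\<close>

definition pts2 :: "'p fm set pattern set" where
  "pts2 = {(S, lab, [x, y]) |S lab x y. realizable S lab \<and> x \<in> S \<and> y \<in> S \<and> strict_prefix x y}"

lemma wqo_pts1: "wqo_on pattern_le pts1" and wqo_pts2: "wqo_on pattern_le pts2"
proof -
  have "lab ` S \<subseteq> Pow \<Sigma>" if "realizable S lab" for S lab
    using that by (auto simp: realizable_def)
  then have sub: "pts1 \<subseteq> {(S, lab, xs). tree S \<and> lab ` S \<subseteq> Pow \<Sigma> \<and> set xs \<subseteq> S \<and> length xs = 1}"
    "pts2 \<subseteq> {(S, lab, xs). tree S \<and> lab ` S \<subseteq> Pow \<Sigma> \<and> set xs \<subseteq> S \<and> length xs = 2}"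
    unfolding pts1_def pts2_def by (auto dest: realizable_tree)
  then show "wqo_on pattern_le pts1" "wqo_on pattern_le pts2"
    using finite_\<Sigma>
    by (simp_all add: wqo_on_subset[OF wqo_pattern_le sub(1)] wqo_on_subset[OF wqo_pattern_le sub(2)])
qed

lemmas order1 = wqo_pts1 transp_pattern_le reflp_pattern_le
lemmas order2 = wqo_pts2 transp_pattern_le reflp_pattern_le

lemma pts2_point:
  assumes "(S, lab, xs) \<in> pts2" "i < 2"
  shows "i < length xs" "(S, lab, [xs ! i]) \<in> pts1"
  using assms by (auto simp: pts1_def pts2_def less_Suc_eq numeral_2_eq_2)

lemma pts2_hom:
  assumes "(S, lab, xs) \<in> pts2" "tree_hom h (S, l) (S', lab')" "realizable S' lab'"
  shows "(S', lab', map h xs) \<in> pts2"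
  using assms by (auto simp: pts2_def tree_hom_def)

lemma pts1_cases:
  assumes "P \<in> pts1"
  obtains S lab x where "P = (S, lab, [x])" "realizable S lab" "x \<in> S"
  using assms by (auto simp: pts1_def)

text \<open>One point is forgotten and the result closed downward in \<open>pts1\<close>, since a
  pattern below a one-point pattern has no designated second node.\<close>

definition proj :: "nat \<Rightarrow> 'p fm set pattern set \<Rightarrow> 'p fm set pattern set" where
  "proj i B = {P\<in>pts1. \<exists>S lab xs. (S, lab, xs) \<in> B \<and> pattern_le P (S, lab, [xs ! i])}"

lemma proj_point: "(S, lab, xs) \<in> B \<Longrightarrow> B \<subseteq> pts2 \<Longrightarrow> i < 2 \<Longrightarrow> (S, lab, [xs ! i]) \<in> proj i B"
  unfolding proj_def using pts2_point pattern_le_refl by blast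

lemma ideal_proj:
  assumes B: "ideal pattern_le pts2 B" and i: "i < 2"
  shows "ideal pattern_le pts1 (proj i B)"
proof -
  have sub: "B \<subseteq> pts2" using B by (rule ideal_subset)
  have "B \<noteq> {}" using ideal_directed[OF B] by (simp add: directed_def)
  then have "proj i B \<noteq> {}" using proj_point[OF _ sub i] by (metis all_not_in_conv prod_cases3)
  moreover have "\<exists>U\<in>proj i B. pattern_le P U \<and> pattern_le Q U"
    if PQ: "P \<in> proj i B" "Q \<in> proj i B" for P Q
  proof -
    obtain S lab xs S' lab' xs'
      where *: "(S, lab, xs) \<in> B" "pattern_le P (S, lab, [xs ! i])"
        "(S', lab', xs') \<in> B" "pattern_le Q (S', lab', [xs' ! i])"
      using PQ unfolding proj_def by blast
    obtain T l ys where T: "(T, l, ys) \<in> B" "pattern_le (S, lab, xs) (T, l, ys)"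
      "pattern_le (S', lab', xs') (T, l, ys)"
      using directed_bound[OF ideal_directed[OF B] *(1,3)] by (metis prod_cases3)
    have "pattern_le (S, lab, [xs ! i]) (T, l, [ys ! i])"
      "pattern_le (S', lab', [xs' ! i]) (T, l, [ys ! i])"
      using T(2,3) *(1,3) sub pts2_point(1)[OF _ i] pattern_le_point by blast+
    then show ?thesis
      using *(2,4) proj_point[OF T(1) sub i] pattern_le_trans by blast
  qed
  moreover have "down_closed pattern_le pts1 (proj i B)"
    unfolding down_closed_def proj_def using pattern_le_trans by blast
  ultimately show ?thesis by (simp add: ideal_def directed_def)
qed

text \<open>If a larger ideal \<open>K\<close> contained some \<open>q\<close> outside the projection, then upper bounds in \<open>K\<close> of \<open>q\<close>
  and the projected members of \<open>B\<close>, with both points of \<open>B\<close> transported along, would enlarge \<open>B\<close>.\<close>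

lemma max_ideal_proj:
  assumes B: "max_ideal pattern_le pts2 B" and i: "i < 2"
  shows "max_ideal pattern_le pts1 (proj i B)"
  unfolding max_ideal_def
proof (intro conjI allI impI)
  have BI: "ideal pattern_le pts2 B" using B by (rule max_ideal_ideal)
  then have sub: "B \<subseteq> pts2" by (rule ideal_subset)
  show "ideal pattern_le pts1 (proj i B)" by (rule ideal_proj[OF BI i])
  fix K assume K: "ideal pattern_le pts1 K" "proj i B \<subseteq> K"
  have "q \<in> proj i B" if q: "q \<in> K" for q
  proof -
    define E where "E c c' \<longleftrightarrow> pattern_le c c' \<and>
      (case c' of (S, lab, xs) \<Rightarrow> pattern_le q (S, lab, [xs ! i]))" for c c'
    have "\<exists>c'\<in>pts2. E c c'" if c: "c \<in> B" for c
    proof -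
      obtain S lab xs where c_eq: "c = (S, lab, xs)" by (cases c)
      then have c2: "(S, lab, xs) \<in> pts2" using c sub by blast
      have "(S, lab, [xs ! i]) \<in> K" using proj_point[OF _ sub i] c c_eq K(2) by blast
      then obtain U where U: "U \<in> K" "pattern_le q U" "pattern_le (S, lab, [xs ! i]) U"
        using directed_bound[OF ideal_directed[OF K(1)] q] by blast
      then have "U \<in> pts1" using ideal_subset[OF K(1)] by blast
      then obtain T l z where T: "U = (T, l, [z])" "realizable T l" by (rule pts1_cases)
      then obtain h where h: "tree_hom h (S, lab) (T, l)" "h (xs ! i) = z"
        using U(3) by (auto simp: pattern_le_iff)
      have "(T, l, map h xs) \<in> pts2" using c2 h(1) T(2) by (rule pts2_hom)
      moreover have "pattern_le c (T, l, map h xs)"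
        using h(1) c_eq by (auto simp: pattern_le_iff)
      moreover have "[map h xs ! i] = [z]" using h(2) pts2_point(1)[OF c2 i] by simp
      ultimately show ?thesis using U(2) T(1) by (auto simp: E_def intro!: bexI[of _ "(T, l, map h xs)"])
    qed
    then obtain B' where B': "max_ideal pattern_le pts2 B'"
      "\<forall>c\<in>B. \<exists>d\<in>B. pattern_le c d \<and> (\<exists>a\<in>B'. E d a)"
      using max_ideal_pigeonhole[OF ideal_directed[OF BI] transp_pattern_le order2, of E] by blast
    have "B \<subseteq> B'"
    proof
      fix c assume "c \<in> B"
      then obtain d a where "pattern_le c d" "a \<in> B'" "E d a" using B'(2) by blast
      then have "pattern_le c a" using pattern_le_trans unfolding E_def by blast
      then show "c \<in> B'"
        using ideal_down[OF max_ideal_ideal[OF B'(1)] \<open>a \<in> B'\<close>] \<open>c \<in> B\<close> sub by blast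
    qed
    then have "B' = B" using max_ideal_eq[OF B max_ideal_ideal[OF B'(1)]] by blast
    moreover have "B \<noteq> {}" using ideal_directed[OF BI] by (simp add: directed_def)
    ultimately obtain d a where "a \<in> B" "E d a" using B'(2) by blast
    then show ?thesis
      using q ideal_subset[OF K(1)] unfolding proj_def E_def by (auto split: prod.splits)
  qed
  then show "K = proj i B" using K(2) by blast
qed

definition world_le :: "'p fm set pattern set \<Rightarrow> 'p fm set pattern set \<Rightarrow> bool" where
  "world_le J K \<longleftrightarrow> (\<forall>S lab x. (S, lab, [x]) \<in> J \<longrightarrow>
    (\<exists>lab'. (\<forall>p\<in>S. lab p \<subseteq> lab' p) \<and> (S, lab', [x]) \<in> K))"

lemma pull_back:
  assumes K: "ideal pattern_le pts1 K" and mem: "(S', l', [h y]) \<in> K"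
    and h: "tree_hom h (S, l' \<circ> h) (S', l')" and S: "tree S" "y \<in> S"
  shows "(S, l' \<circ> h, [y]) \<in> K"
proof (rule ideal_down[OF K mem])
  have "realizable S' l'" using mem ideal_subset[OF K] by (auto simp: pts1_def)
  then have "realizable S (l' \<circ> h)" using S(1) h by (rule realizable_hom)
  then show "(S, l' \<circ> h, [y]) \<in> pts1" using S(2) by (auto simp: pts1_def)
  show "pattern_le (S, l' \<circ> h, [y]) (S', l', [h y])" using h by (auto simp: pattern_le_iff)
qed

text \<open>It suffices to treat cofinally many members of \<open>J\<close>, and the enlarged
  labelling may live on a larger tree: an arbitrary member maps into a treated one, and the new
  labels are pulled back along that homomorphism.\<close>

lemma world_leI:
  assumes J: "ideal pattern_le pts1 J" and K: "ideal pattern_le pts1 K"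
    and ex: "\<And>P. P \<in> J \<Longrightarrow> \<exists>S lab x S' lab'. pattern_le P (S, lab, [x]) \<and>
      S \<subseteq> S' \<and> (\<forall>p\<in>S. lab p \<subseteq> lab' p) \<and> (S', lab', [x]) \<in> K"
  shows "world_le J K"
  unfolding world_le_def
proof (intro allI impI)
  fix S lab x assume P: "(S, lab, [x]) \<in> J"
  then have S: "tree S" "x \<in> S"
    using ideal_subset[OF J] by (auto simp: pts1_def dest: realizable_tree)
  obtain S1 l1 x1 S1' l1' where *: "pattern_le (S, lab, [x]) (S1, l1, [x1])" "S1 \<subseteq> S1'"
    "\<forall>p\<in>S1. l1 p \<subseteq> l1' p" "(S1', l1', [x1]) \<in> K"
    using ex[OF P] by blast
  then obtain h where h: "tree_hom h (S, lab) (S1, l1)" "h x = x1"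
    by (auto simp: pattern_le_iff)
  have "(S, l1' \<circ> h, [x]) \<in> K"
    using *(4) h(2) tree_hom_relabel[OF h(1) *(2)] S by (intro pull_back[OF K]) auto
  moreover have "\<forall>p\<in>S. lab p \<subseteq> (l1' \<circ> h) p"
    using h(1) *(3) by (auto simp: tree_hom_def)
  ultimately show "\<exists>lab'. (\<forall>p\<in>S. lab p \<subseteq> lab' p) \<and> (S, lab', [x]) \<in> K" by blast
qed

text \<open>Exchanging \<open>i\<close> and \<open>j\<close> gives forward and backward confluence
  at once. Demands are pairs from \<open>K\<close> and \<open>B\<close>. The component in
  \<open>K\<close> ensures that \<open>proj i B'\<close> contains \<open>K\<close>, hence equals it;
  the component in \<open>B\<close> ensures that \<open>proj j B'\<close> dominates
  \<open>proj j B\<close>. Raised labels come from \<open>world_le\<close> and not from the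
  canonical model.\<close>

lemma confluence:
  assumes B: "max_ideal pattern_le pts2 B" and i: "i < 2" and j: "j < 2"
    and K: "max_ideal pattern_le pts1 K" and le: "world_le (proj i B) K"
  shows "\<exists>B'. max_ideal pattern_le pts2 B' \<and> proj i B' = K \<and> world_le (proj j B) (proj j B')"
proof -
  have BI: "ideal pattern_le pts2 B" and KI: "ideal pattern_le pts1 K"
    by (rule max_ideal_ideal[OF B], rule max_ideal_ideal[OF K])
  have sub: "B \<subseteq> pts2" using BI by (rule ideal_subset)
  define q :: "'p fm set pattern \<times> 'p fm set pattern \<Rightarrow> 'p fm set pattern \<times> 'p fm set pattern \<Rightarrow> bool"
    where "q = (\<lambda>(P, b) (P', b'). pattern_le P P' \<and> pattern_le b b')"
  \<comment> \<open>A solution arises by enlarging the labels \<open>lab\<close> to \<open>l\<close>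
    on the same tree, so that its \<open>i\<close>-th pointing falls into \<open>K\<close>, and then
    moving by \<open>h\<close> to an upper bound with \<open>P\<close> in \<open>K\<close>; all
    points move with \<open>h\<close>.\<close>
  define E :: "'p fm set pattern \<times> 'p fm set pattern \<Rightarrow> 'p fm set pattern \<Rightarrow> bool"
    where "E = (\<lambda>(P, S, lab, xs) (S', lab', xs').
    \<exists>l h. (\<forall>p\<in>S. lab p \<subseteq> l p) \<and> tree_hom h (S, l) (S', lab') \<and> map h xs = xs' \<and>
      pattern_le P (S', lab', [xs' ! i]))"
  have "directed q (K \<times> B)"
    unfolding q_def using ideal_directed[OF KI] ideal_directed[OF BI] by (rule directed_times)
  moreover have "transp q"
    unfolding q_def by (rule transpI) (auto intro: pattern_le_trans)
  moreover have "\<exists>a\<in>pts2. E d a" if d: "d \<in> K \<times> B" for d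
  proof -
    obtain P S lab xs where d_eq: "d = (P, S, lab, xs)" by (cases d) auto
    then have P: "P \<in> K" and b: "(S, lab, xs) \<in> B" using d by auto
    then have b2: "(S, lab, xs) \<in> pts2" using sub by blast
    obtain l where l: "\<forall>p\<in>S. lab p \<subseteq> l p" "(S, l, [xs ! i]) \<in> K"
      using le proj_point[OF b sub i] unfolding world_le_def by blast
    then obtain U where U: "U \<in> K" "pattern_le P U" "pattern_le (S, l, [xs ! i]) U"
      using directed_bound[OF ideal_directed[OF KI] P] by blast
    then have "U \<in> pts1" using ideal_subset[OF KI] by blast
    then obtain T l' z where T: "U = (T, l', [z])" "realizable T l'" by (rule pts1_cases)
    then obtain h where h: "tree_hom h (S, l) (T, l')" "h (xs ! i) = z"
      using U(3) by (auto simp: pattern_le_iff)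
    have "(T, l', map h xs) \<in> pts2" using b2 h(1) T(2) by (rule pts2_hom)
    moreover have "map h xs ! i = z" using h(2) pts2_point(1)[OF b2 i] by simp
    ultimately show ?thesis
      using U(2) T(1) l(1) h(1) d_eq by (intro bexI[of _ "(T, l', map h xs)"]) (auto simp: E_def)
  qed
  ultimately obtain B' where B': "max_ideal pattern_le pts2 B'"
    "\<forall>d\<in>K \<times> B. \<exists>d'\<in>K \<times> B. q d d' \<and> (\<exists>a\<in>B'. E d' a)"
    using max_ideal_pigeonhole[OF _ _ order2, of q "K \<times> B" E] by blast
  have B'I: "ideal pattern_le pts2 B'" using B'(1) by (rule max_ideal_ideal)
  then have sub': "B' \<subseteq> pts2" by (rule ideal_subset)
  have step: "\<exists>P' S lab xs S' lab' l h. pattern_le P P' \<and> pattern_le b (S, lab, xs) \<and>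
      (S, lab, xs) \<in> B \<and> (S', lab', map h xs) \<in> B' \<and> (\<forall>p\<in>S. lab p \<subseteq> l p) \<and>
      tree_hom h (S, l) (S', lab') \<and> pattern_le P' (S', lab', [map h xs ! i])"
    if PB: "P \<in> K" "b \<in> B" for P b
  proof -
    have "(P, b) \<in> K \<times> B" using PB by simp
    then obtain d' a where d': "d' \<in> K \<times> B" "q (P, b) d'" "a \<in> B'" "E d' a"
      using B'(2) by blast
    obtain P' S lab xs S' lab' xs' where eq: "d' = (P', S, lab, xs)" "a = (S', lab', xs')"
      by (cases d', cases a) auto
    have "\<exists>l h. (\<forall>p\<in>S. lab p \<subseteq> l p) \<and> tree_hom h (S, l) (S', lab') \<and> map h xs = xs' \<and>
        pattern_le P' (S', lab', [xs' ! i])"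
      using d'(4) unfolding E_def eq by simp
    then obtain l h where lh: "\<forall>p\<in>S. lab p \<subseteq> l p" "tree_hom h (S, l) (S', lab')" "xs' = map h xs"
      "pattern_le P' (S', lab', [xs' ! i])"
      by blast
    moreover have "(S, lab, xs) \<in> B" "pattern_le P P'" "pattern_le b (S, lab, xs)"
      using d'(1,2) by (simp_all add: q_def eq)
    moreover have "(S', lab', map h xs) \<in> B'"
      using d'(3) by (simp add: eq lh(3))
    ultimately show ?thesis by (intro exI conjI) (assumption | simp)+
  qed
  obtain b0 where "b0 \<in> B" using ideal_directed[OF BI] by (auto simp: directed_def)
  have "K \<subseteq> proj i B'"
  proof
    fix P assume "P \<in> K"
    then obtain P' S' lab' ys where "pattern_le P P'" "(S', lab', ys) \<in> B'"
      "pattern_le P' (S', lab', [ys ! i])"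
      using step[OF _ \<open>b0 \<in> B\<close>] by blast
    then show "P \<in> proj i B'"
      using \<open>P \<in> K\<close> ideal_subset[OF KI] pattern_le_trans unfolding proj_def by blast
  qed
  then have "proj i B' = K"
    using max_ideal_eq[OF K ideal_proj[OF B'I i]] by blast
  moreover have "world_le (proj j B) (proj j B')"
  proof (rule world_leI[OF ideal_proj[OF BI j] ideal_proj[OF B'I j]])
    fix P assume "P \<in> proj j B"
    then obtain S0 lab0 xs0 where P: "(S0, lab0, xs0) \<in> B" "pattern_le P (S0, lab0, [xs0 ! j])"
      unfolding proj_def by blast
    obtain P0 where "P0 \<in> K" using ideal_directed[OF KI] by (auto simp: directed_def)
    then obtain S lab xs S' lab' l h where *: "pattern_le (S0, lab0, xs0) (S, lab, xs)"
      "(S, lab, xs) \<in> B" "(S', lab', map h xs) \<in> B'" "\<forall>p\<in>S. lab p \<subseteq> l p"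
      "tree_hom h (S, l) (S', lab')"
      using step[OF _ P(1)] by blast
    have S: "tree S" "xs ! j \<in> S"
      using pts2_point(2)[OF subsetD[OF sub *(2)] j] by (auto simp: pts1_def dest: realizable_tree)
    have "pattern_le P (S, lab, [xs ! j])"
      using P(2) pattern_le_point[OF *(1)] pts2_point(1)[OF subsetD[OF sub P(1)] j]
        pattern_le_trans by blast
    moreover have "(S', lab', [h (xs ! j)]) \<in> proj j B'"
      using proj_point[OF *(3) sub' j] pts2_point(1)[OF subsetD[OF sub *(2)] j] by simp
    then have "(S, lab' \<circ> h, [xs ! j]) \<in> proj j B'"
      using tree_hom_relabel[OF *(5)] S by (intro pull_back[OF ideal_proj[OF B'I j]]) auto
    moreover have "\<forall>p\<in>S. lab p \<subseteq> (lab' \<circ> h) p"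
      using *(4,5) by (auto simp: tree_hom_def)
    ultimately show "\<exists>S lab x S' lab'. pattern_le P (S, lab, [x]) \<and>
      S \<subseteq> S' \<and> (\<forall>p\<in>S. lab p \<subseteq> lab' p) \<and> (S', lab', [x]) \<in> proj j B'" by blast
  qed
  ultimately show ?thesis using B'(1) by blast
qed

section \<open>Types of worlds and witnesses for the connectives\<close>

definition label :: "'p fm set pattern set \<Rightarrow> 'p fm set" where
  "label J = \<Union>{lab x |S lab x. (S, lab, [x]) \<in> J}"

text \<open>Two members of an ideal have a common upper bound, and homomorphisms preserve both the
  points and their labels. The union in \<open>label\<close> thus runs over a single set.\<close>

lemma label_eq:
  assumes J: "ideal pattern_le pts1 J" and P: "(S, lab, [x]) \<in> J"
  shows "label J = lab x"
proof -
  have "l y = lab x" if Q: "(T, l, [y]) \<in> J" for T l y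
  proof -
    obtain U where U: "U \<in> J" "pattern_le (S, lab, [x]) U" "pattern_le (T, l, [y]) U"
      using directed_bound[OF ideal_directed[OF J] P Q] by blast
    obtain S' lab' xs where U_eq: "U = (S', lab', xs)" by (cases U)
    have "x \<in> S" "y \<in> T" using P Q ideal_subset[OF J] by (auto simp: pts1_def)
    then show ?thesis using U(2,3) unfolding U_eq pattern_le_iff tree_hom_def by fastforce
  qed
  then have "{lab x |S lab x. (S, lab, [x]) \<in> J} = {lab x}" using P by blast
  then show ?thesis by (simp add: label_def)
qed

lemma ideal_obtain:
  assumes "ideal pattern_le pts1 J"
  obtains S lab x where "(S, lab, [x]) \<in> J" "realizable S lab" "x \<in> S"
proof -
  obtain P where P: "P \<in> J" using ideal_directed[OF assms] by (auto simp: directed_def)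
  then have "P \<in> pts1" using ideal_subset[OF assms] by blast
  then show thesis using P that by (elim pts1_cases) simp
qed

definition worlds1 :: "'p fm set pattern set set" where
  "worlds1 = {J. max_ideal pattern_le pts1 J}"

definition world_le_rel :: "'p fm set pattern set rel" where
  "world_le_rel = {(J, K). J \<in> worlds1 \<and> K \<in> worlds1 \<and> world_le J K}"

definition world_acc :: "'p fm set pattern set rel" where
  "world_acc = {(proj 0 B, proj 1 B) |B. max_ideal pattern_le pts2 B}"

lemma worlds1_ideal: "J \<in> worlds1 \<Longrightarrow> ideal pattern_le pts1 J"
  by (simp add: worlds1_def max_ideal_ideal)

lemma world_label:
  assumes "J \<in> worlds1"
  obtains w where "prime w" "label J = w \<inter> \<Sigma>"
proof -
  have J: "ideal pattern_le pts1 J" using assms by (rule worlds1_ideal)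
  then obtain S lab x where P: "(S, lab, [x]) \<in> J" "realizable S lab" "x \<in> S"
    by (rule ideal_obtain)
  then obtain g where "realizes g S" "lab x = g x \<inter> \<Sigma>" by (auto simp: realizable_def)
  then show thesis using that label_eq[OF J P(1)] P(3) by (auto simp: realizes_def)
qed

lemma proj_worlds1: "max_ideal pattern_le pts2 B \<Longrightarrow> i < 2 \<Longrightarrow> proj i B \<in> worlds1"
  by (simp add: worlds1_def max_ideal_proj)

lemma label_proj:
  assumes B: "max_ideal pattern_le pts2 B" and b: "(S, lab, xs) \<in> B" and i: "i < 2"
  shows "label (proj i B) = lab (xs ! i)"
proof (rule label_eq)
  have BI: "ideal pattern_le pts2 B" using B by (rule max_ideal_ideal)
  show "ideal pattern_le pts1 (proj i B)" by (rule ideal_proj[OF BI i])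
  show "(S, lab, [xs ! i]) \<in> proj i B" by (rule proj_point[OF b ideal_subset[OF BI] i])
qed

text \<open>One member of the underlying ideal is enough: labels do not vary within an ideal, and
  its two points are comparable in a realized tree.\<close>

lemma acc_label:
  assumes "(J, K) \<in> world_acc"
  obtains w v where "prime w" "prime v" "can_acc w v" "label J = w \<inter> \<Sigma>" "label K = v \<inter> \<Sigma>"
proof -
  obtain B where B: "max_ideal pattern_le pts2 B" and JK: "J = proj 0 B" "K = proj 1 B"
    using assms by (auto simp: world_acc_def)
  have BI: "ideal pattern_le pts2 B" using B by (rule max_ideal_ideal)
  obtain b where b: "b \<in> B" using ideal_directed[OF BI] by (auto simp: directed_def)
  then have "b \<in> pts2" using ideal_subset[OF BI] by blast
  then obtain S lab x y where b_eq: "b = (S, lab, [x, y])" "realizable S lab"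
    "x \<in> S" "y \<in> S" "strict_prefix x y"
    by (auto simp: pts2_def)
  then obtain g where g: "tree S" "realizes g S" "\<forall>p\<in>S. lab p = g p \<inter> \<Sigma>"
    by (auto simp: realizable_def)
  have "can_acc (g x) (g y)"
    using realizes_can_acc[OF g(1,2) b_eq(4,5)] by blast
  moreover have "prime (g x)" "prime (g y)" using g(2) b_eq(3,4) by (auto simp: realizes_def)
  moreover have "label J = g x \<inter> \<Sigma>" "label K = g y \<inter> \<Sigma>"
    using label_proj[OF B, of S lab "[x, y]"] b b_eq JK g(3) by simp_all
  ultimately show thesis using that by blast
qed

lemma world_le_label: "(J, K) \<in> world_le_rel \<Longrightarrow> label J \<subseteq> label K"
proof -
  assume "(J, K) \<in> world_le_rel"
  then have JK: "ideal pattern_le pts1 J" "ideal pattern_le pts1 K" "world_le J K"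
    by (auto simp: world_le_rel_def worlds1_ideal)
  obtain S lab x where P: "(S, lab, [x]) \<in> J" "x \<in> S" by (rule ideal_obtain[OF JK(1)])
  then obtain lab' where "\<forall>p\<in>S. lab p \<subseteq> lab' p" "(S, lab', [x]) \<in> K"
    using JK(3) unfolding world_le_def by blast
  then show ?thesis using label_eq[OF JK(1) P(1)] label_eq[OF JK(2)] P(2) by auto
qed

text \<open>Each member of \<open>J\<close> is realized separately and its point raised to a theory
  that refutes the implication. These theories may differ from member to member; the pigeonhole
  argument gathers the results in one world.\<close>

lemma world_imp_witness:
  assumes J: "J \<in> worlds1" and AB: "Imp A B \<in> \<Sigma>" "Imp A B \<notin> label J" "A \<in> \<Sigma>"
  shows "\<exists>K. (J, K) \<in> world_le_rel \<and> A \<in> label K \<and> B \<notin> label K"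
proof -
  have JI: "ideal pattern_le pts1 J" using J by (rule worlds1_ideal)
  define E where "E P Q \<longleftrightarrow> (\<exists>S lab lab' x. P = (S, lab, [x]) \<and> Q = (S, lab', [x]) \<and>
    (\<forall>p\<in>S. lab p \<subseteq> lab' p) \<and> A \<in> lab' x \<and> B \<notin> lab' x)" for P Q :: "'p fm set pattern"
  have "\<exists>Q\<in>pts1. E P Q" if P: "P \<in> J" for P
  proof -
    have "P \<in> pts1" using P ideal_subset[OF JI] by blast
    then obtain S lab x where P_eq: "P = (S, lab, [x])" "realizable S lab" "x \<in> S"
      by (rule pts1_cases)
    then obtain g where g: "tree S" "realizes g S" "\<forall>p\<in>S. lab p = g p \<inter> \<Sigma>"
      by (auto simp: realizable_def)
    \<comment> \<open>The label only shows the part of \<open>g x\<close> inside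
      \<open>\<Sigma>\<close>, which decides the matter because the implication belongs to
      \<open>\<Sigma>\<close>.\<close>
    have "Imp A B \<notin> g x"
      using AB(1,2) label_eq[OF JI, of S lab x] P P_eq g(3) by auto
    moreover have "prime (g x)" using g(2) P_eq(3) by (simp add: realizes_def)
    ultimately obtain w where w: "prime w" "g x \<subseteq> w" "A \<in> w" "B \<notin> w"
      using can_imp_witness by blast
    obtain g' where g': "realizes g' S" "\<forall>p\<in>S. g p \<subseteq> g' p" "g' x = w"
      using realizes_raise[OF g(1,2) P_eq(3) w(1,2)] by blast
    have "realizable S (\<lambda>p. g' p \<inter> \<Sigma>)" using g(1) g'(1) by (auto simp: realizable_def)
    then have "(S, \<lambda>p. g' p \<inter> \<Sigma>, [x]) \<in> pts1" using P_eq(3) by (auto simp: pts1_def)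
    moreover have "E P (S, \<lambda>p. g' p \<inter> \<Sigma>, [x])"
      using P_eq(1) g(3) g'(2,3) w(3,4) AB(3) unfolding E_def by auto
    ultimately show ?thesis by blast
  qed
  then obtain K where K: "max_ideal pattern_le pts1 K"
    "\<forall>P\<in>J. \<exists>P'\<in>J. pattern_le P P' \<and> (\<exists>Q\<in>K. E P' Q)"
    using max_ideal_pigeonhole[OF ideal_directed[OF JI] transp_pattern_le order1, of E] by blast
  have KI: "ideal pattern_le pts1 K" using K(1) by (rule max_ideal_ideal)
  have "world_le J K"
  proof (rule world_leI[OF JI KI])
    fix P assume "P \<in> J"
    then obtain P' Q where "pattern_le P P'" "Q \<in> K" "E P' Q" using K(2) by blast
    then show "\<exists>S lab x S' lab'. pattern_le P (S, lab, [x]) \<and>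
        S \<subseteq> S' \<and> (\<forall>p\<in>S. lab p \<subseteq> lab' p) \<and> (S', lab', [x]) \<in> K"
      unfolding E_def by blast
  qed
  moreover obtain P where "P \<in> J" using ideal_directed[OF JI] by (auto simp: directed_def)
  then obtain P' Q where Q: "Q \<in> K" "E P' Q" using K(2) by blast
  then obtain S lab' x where "Q = (S, lab', [x])" "A \<in> lab' x" "B \<notin> lab' x"
    unfolding E_def by blast
  then have "A \<in> label K" "B \<notin> label K" using label_eq[OF KI, of S lab' x] Q(1) by auto
  ultimately show ?thesis
    using J K(1) by (auto simp: world_le_rel_def worlds1_def)
qed

text \<open>The point is raised to \<open>u\<close>, and the refuting successor \<open>v\<close> is
  grafted as a new child. Hence the solution lives on a larger tree with raised labels, the
  situation for which \<open>world_leI\<close> is made.\<close>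

lemma world_box_witness:
  assumes J: "J \<in> worlds1" and A: "Box A \<in> \<Sigma>" "Box A \<notin> label J"
  shows "\<exists>K M. (J, K) \<in> world_le_rel \<and> (K, M) \<in> world_acc \<and> A \<notin> label M"
proof -
  have JI: "ideal pattern_le pts1 J" using J by (rule worlds1_ideal)
  define E where "E P Q \<longleftrightarrow> (\<exists>S lab x S' lab' y. P = (S, lab, [x]) \<and> Q = (S', lab', [x, y]) \<and>
    S \<subseteq> S' \<and> (\<forall>p\<in>S. lab p \<subseteq> lab' p) \<and> A \<notin> lab' y)" for P Q :: "'p fm set pattern"
  have "\<exists>Q\<in>pts2. E P Q" if P: "P \<in> J" for P
  proof -
    have "P \<in> pts1" using P ideal_subset[OF JI] by blast
    then obtain S lab x where P_eq: "P = (S, lab, [x])" "realizable S lab" "x \<in> S"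
      by (rule pts1_cases)
    then obtain g where g: "tree S" "realizes g S" "\<forall>p\<in>S. lab p = g p \<inter> \<Sigma>"
      by (auto simp: realizable_def)
    have "Box A \<notin> g x"
      using A label_eq[OF JI, of S lab x] P P_eq g(3) by auto
    moreover have "prime (g x)" using g(2) P_eq(3) by (simp add: realizes_def)
    ultimately obtain u v where uv: "prime u" "prime v" "g x \<subseteq> u" "can_acc u v" "A \<notin> v"
      using can_box_witness by blast
    obtain g1 where g1: "realizes g1 S" "\<forall>p\<in>S. g p \<subseteq> g1 p" "g1 x = u"
      using realizes_raise[OF g(1,2) P_eq(3) uv(1,3)] by blast
    have "can_acc (g1 x) v" using g1(3) uv(4) by simp
    then obtain S' g' y where S': "tree S'" "S \<subseteq> S'" "y \<in> S'" "strict_prefix x y" "realizes g' S'"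
      "\<And>p. p \<in> S \<Longrightarrow> g' p = g1 p" "g' y = v"
      using realizes_new_child[OF g(1) g1(1) P_eq(3) uv(2)] by metis
    have "realizable S' (\<lambda>p. g' p \<inter> \<Sigma>)" using S'(1,5) by (auto simp: realizable_def)
    then have "(S', \<lambda>p. g' p \<inter> \<Sigma>, [x, y]) \<in> pts2"
      using P_eq(3) S'(2,3,4) by (auto simp: pts2_def)
    moreover have "\<forall>p\<in>S. lab p \<subseteq> g' p \<inter> \<Sigma>" using g(3) g1(2) S'(6) by auto
    then have "E P (S', \<lambda>p. g' p \<inter> \<Sigma>, [x, y])"
      using P_eq(1) S'(2,7) uv(5) unfolding E_def by simp
    ultimately show ?thesis by blast
  qed
  then obtain B where B: "max_ideal pattern_le pts2 B"
    "\<forall>P\<in>J. \<exists>P'\<in>J. pattern_le P P' \<and> (\<exists>Q\<in>B. E P' Q)"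
    using max_ideal_pigeonhole[OF ideal_directed[OF JI] transp_pattern_le order2, of E] by blast
  have BI: "ideal pattern_le pts2 B" using B(1) by (rule max_ideal_ideal)
  have "world_le J (proj 0 B)"
  proof (rule world_leI[OF JI ideal_proj[OF BI]])
    fix P assume "P \<in> J"
    then obtain P' Q where Q: "pattern_le P P'" "Q \<in> B" "E P' Q" using B(2) by blast
    then obtain S lab x S' lab' y where eq: "P' = (S, lab, [x])" "Q = (S', lab', [x, y])"
      "S \<subseteq> S'" "\<forall>p\<in>S. lab p \<subseteq> lab' p"
      unfolding E_def by blast
    have "(S', lab', [x]) \<in> proj 0 B"
      using proj_point[of S' lab' "[x, y]" B 0] Q(2) ideal_subset[OF BI] eq(2) by simp
    then show "\<exists>S lab x S' lab'. pattern_le P (S, lab, [x]) \<and>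
        S \<subseteq> S' \<and> (\<forall>p\<in>S. lab p \<subseteq> lab' p) \<and> (S', lab', [x]) \<in> proj 0 B"
      using Q(1) eq by blast
  qed simp
  moreover obtain P where "P \<in> J" using ideal_directed[OF JI] by (auto simp: directed_def)
  then obtain P' Q where Q: "Q \<in> B" "E P' Q" using B(2) by blast
  then obtain S' lab' x y where "Q = (S', lab', [x, y])" "A \<notin> lab' y"
    unfolding E_def by blast
  then have "A \<notin> label (proj 1 B)" using label_proj[OF B(1), of S' lab' "[x, y]" 1] Q(1) by simp
  ultimately show ?thesis
    using J B(1) proj_worlds1[OF B(1), of 0] by (auto simp: world_le_rel_def world_acc_def)
qed

text \<open>Here nothing is raised: the new child leaves all old labels unchanged, so each member of
  \<open>J\<close> maps identically into its solution. This gives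
  \<open>J \<subseteq> proj 0 B\<close> and, by maximality, a successor of \<open>J\<close>
  itself.\<close>

lemma world_dia_witness:
  assumes J: "J \<in> worlds1" and A: "A \<in> \<Sigma>" "Dia A \<in> label J"
  shows "\<exists>K. (J, K) \<in> world_acc \<and> A \<in> label K"
proof -
  have JI: "ideal pattern_le pts1 J" using J by (rule worlds1_ideal)
  define E where "E P Q \<longleftrightarrow> (\<exists>x S' lab' y. Q = (S', lab', [x, y]) \<and>
    pattern_le P (S', lab', [x]) \<and> A \<in> lab' y)" for P Q :: "'p fm set pattern"
  have "\<exists>Q\<in>pts2. E P Q" if P: "P \<in> J" for P
  proof -
    have "P \<in> pts1" using P ideal_subset[OF JI] by blast
    then obtain S lab x where P_eq: "P = (S, lab, [x])" "realizable S lab" "x \<in> S"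
      by (rule pts1_cases)
    then obtain g where g: "tree S" "realizes g S" "\<forall>p\<in>S. lab p = g p \<inter> \<Sigma>"
      by (auto simp: realizable_def)
    have "Dia A \<in> g x"
      using A label_eq[OF JI, of S lab x] P P_eq g(3) by auto
    moreover have "prime (g x)" using g(2) P_eq(3) by (simp add: realizes_def)
    ultimately obtain v where v: "prime v" "can_acc (g x) v" "A \<in> v"
      using can_dia_witness by blast
    obtain S' g' y where S': "tree S'" "S \<subseteq> S'" "y \<in> S'" "strict_prefix x y" "realizes g' S'"
      "\<And>p. p \<in> S \<Longrightarrow> g' p = g p" "g' y = v"
      using realizes_new_child[OF g(1,2) P_eq(3) v(1,2)] by metis
    have "realizable S' (\<lambda>p. g' p \<inter> \<Sigma>)" using S'(1,5) by (auto simp: realizable_def)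
    then have "(S', \<lambda>p. g' p \<inter> \<Sigma>, [x, y]) \<in> pts2"
      using P_eq(3) S'(2,3,4) by (auto simp: pts2_def)
    moreover have "tree_hom id (S, lab) (S', \<lambda>p. g' p \<inter> \<Sigma>)"
      using S'(2,6) g(3) by (auto simp: tree_hom_def)
    then have "pattern_le P (S', \<lambda>p. g' p \<inter> \<Sigma>, [x])"
      unfolding P_eq(1) pattern_le_iff by (intro exI[of _ id]) simp
    then have "E P (S', \<lambda>p. g' p \<inter> \<Sigma>, [x, y])"
      using S'(7) v(3) A(1) unfolding E_def by simp
    ultimately show ?thesis by blast
  qed
  then obtain B where B: "max_ideal pattern_le pts2 B"
    "\<forall>P\<in>J. \<exists>P'\<in>J. pattern_le P P' \<and> (\<exists>Q\<in>B. E P' Q)"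
    using max_ideal_pigeonhole[OF ideal_directed[OF JI] transp_pattern_le order2, of E] by blast
  have BI: "ideal pattern_le pts2 B" using B(1) by (rule max_ideal_ideal)
  have "J \<subseteq> proj 0 B"
  proof
    fix P assume P: "P \<in> J"
    then obtain P' Q where Q: "pattern_le P P'" "Q \<in> B" "E P' Q" using B(2) by blast
    then obtain x S' lab' y where eq: "Q = (S', lab', [x, y])" "pattern_le P' (S', lab', [x])"
      unfolding E_def by blast
    have "pattern_le P (S', lab', [[x, y] ! 0])"
      using pattern_le_trans[OF Q(1) eq(2)] by simp
    then show "P \<in> proj 0 B"
      using P ideal_subset[OF JI] Q(2) eq(1) unfolding proj_def by blast
  qed
  then have "proj 0 B = J"
    using J max_ideal_eq[OF _ ideal_proj[OF BI], of J 0] by (simp add: worlds1_def)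
  moreover obtain P where "P \<in> J" using ideal_directed[OF JI] by (auto simp: directed_def)
  then obtain P' Q where Q: "Q \<in> B" "E P' Q" using B(2) by blast
  then obtain x S' lab' y where "Q = (S', lab', [x, y])" "A \<in> lab' y"
    unfolding E_def by blast
  then have "A \<in> label (proj 1 B)" using label_proj[OF B(1), of S' lab' "[x, y]" 1] Q(1) by simp
  ultimately show ?thesis using B(1) by (auto simp: world_acc_def)
qed

lemma world_confluent:
  assumes "(proj i B, K) \<in> world_le_rel" "max_ideal pattern_le pts2 B" "i < 2" "j < 2"
  shows "\<exists>B'. max_ideal pattern_le pts2 B' \<and> proj i B' = K \<and>
    (proj j B, proj j B') \<in> world_le_rel"
  using confluence[OF assms(2-4), of K] assms proj_worlds1[of _ j]
  by (auto simp: world_le_rel_def worlds1_def)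

lemma quasimodel_worlds:
  assumes closed: "subformula_closed \<Sigma>"
  shows "quasimodel worlds1 world_le_rel world_acc label \<Sigma>"
proof
  have sub: "\<And>A B. Conj A B \<in> \<Sigma> \<Longrightarrow> A \<in> \<Sigma> \<and> B \<in> \<Sigma>" "\<And>A B. Disj A B \<in> \<Sigma> \<Longrightarrow> A \<in> \<Sigma> \<and> B \<in> \<Sigma>"
    "\<And>A B. Imp A B \<in> \<Sigma> \<Longrightarrow> A \<in> \<Sigma> \<and> B \<in> \<Sigma>" "\<And>A. Dia A \<in> \<Sigma> \<Longrightarrow> A \<in> \<Sigma>" "\<And>A. Box A \<in> \<Sigma> \<Longrightarrow> A \<in> \<Sigma>"
    by (auto intro: subformula_closedD[OF closed] simp: subfms_refl)
  show "finite worlds1" unfolding worlds1_def by (rule finite_max_ideals[OF order1])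
  show "world_le_rel \<subseteq> worlds1 \<times> worlds1" by (auto simp: world_le_rel_def)
  show "world_acc \<subseteq> worlds1 \<times> worlds1" by (auto simp: world_acc_def proj_worlds1)
  show "(J, J) \<in> world_le_rel" if "J \<in> worlds1" for J
    using that by (auto simp: world_le_rel_def world_le_def)
  show "trans world_le_rel"
  proof (rule transI)
    fix J K M assume JKM: "(J, K) \<in> world_le_rel" "(K, M) \<in> world_le_rel"
    then have "world_le J K" "world_le K M" by (simp_all add: world_le_rel_def)
    then have "world_le J M" unfolding world_le_def by (meson order_trans)
    then show "(J, M) \<in> world_le_rel" using JKM by (simp add: world_le_rel_def)
  qed
  show "forward_confluent world_le_rel world_acc"
    unfolding forward_confluent_def
  proof (intro allI impI, elim conjE)
    fix J K J' assume "(J, K) \<in> world_acc" and le: "(J, J') \<in> world_le_rel"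
    then obtain B where B: "max_ideal pattern_le pts2 B" "J = proj 0 B" "K = proj 1 B"
      by (auto simp: world_acc_def)
    then obtain B' where "max_ideal pattern_le pts2 B'" "proj 0 B' = J'"
      "(proj 1 B, proj 1 B') \<in> world_le_rel"
      using world_confluent[of 0 B J' 1] le by auto
    then show "\<exists>K'. (K, K') \<in> world_le_rel \<and> (J', K') \<in> world_acc"
      using B by (auto simp: world_acc_def)
  qed
  show "backward_confluent world_le_rel world_acc"
    unfolding backward_confluent_def
  proof (intro allI impI, elim conjE)
    fix J K K' assume "(J, K) \<in> world_acc" and le: "(K, K') \<in> world_le_rel"
    then obtain B where B: "max_ideal pattern_le pts2 B" "J = proj 0 B" "K = proj 1 B"
      by (auto simp: world_acc_def)
    then obtain B' where "max_ideal pattern_le pts2 B'" "proj 1 B' = K'"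
      "(proj 0 B, proj 0 B') \<in> world_le_rel"
      using world_confluent[of 1 B K' 0] le by auto
    then show "\<exists>J'. (J, J') \<in> world_le_rel \<and> (J', K') \<in> world_acc"
      using B by (auto simp: world_acc_def)
  qed
  show "label J \<subseteq> label K" if "(J, K) \<in> world_le_rel" for J K
    using that by (rule world_le_label)
  show "subformula_closed \<Sigma>" by (rule closed)
  show "Bot \<notin> label J" if J: "J \<in> worlds1" for J
    by (rule world_label[OF J]) (simp add: prime_def)
  show "Conj A B \<in> label J \<longleftrightarrow> A \<in> label J \<and> B \<in> label J" if J: "J \<in> worlds1" "Conj A B \<in> \<Sigma>" for J A B
    by (rule world_label[OF J(1)]) (use sub(1)[OF J(2)] J(2) theory_Conj_iff[OF prime_theory] in auto)
  show "Disj A B \<in> label J \<longleftrightarrow> A \<in> label J \<or> B \<in> label J" if J: "J \<in> worlds1" "Disj A B \<in> \<Sigma>" for J A B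
  proof (rule world_label[OF J(1)])
    fix w assume w: "prime w" "label J = w \<inter> \<Sigma>"
    have "Disj A B \<in> w \<longleftrightarrow> A \<in> w \<or> B \<in> w"
      using w(1) theory_DisjI[OF prime_theory[OF w(1)], of A B] unfolding prime_def by blast
    then show ?thesis using w(2) sub(2)[OF J(2)] J(2) by simp
  qed
  show "B \<in> label J" if J: "J \<in> worlds1" "Imp A B \<in> label J" "A \<in> label J" "Imp A B \<in> \<Sigma>" for J A B
  proof (rule world_label[OF J(1)])
    fix w assume w: "prime w" "label J = w \<inter> \<Sigma>"
    then show ?thesis
      using theory_mp[OF prime_theory[OF w(1)], of A B] J sub(3)[OF J(4)] by simp
  qed
  show "\<exists>K. (J, K) \<in> world_le_rel \<and> A \<in> label K \<and> B \<notin> label K"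
    if "J \<in> worlds1" "Imp A B \<in> \<Sigma>" "Imp A B \<notin> label J" for J A B
    by (rule world_imp_witness[OF that]) (use sub(3)[OF that(2)] in simp)
  show "A \<in> label K \<and> Box A \<in> label K" if JK: "(J, K) \<in> world_acc" "Box A \<in> \<Sigma>" "Box A \<in> label J" for J K A
  proof (rule acc_label[OF JK(1)])
    fix w v assume "prime w" "can_acc w v" "label J = w \<inter> \<Sigma>" "label K = v \<inter> \<Sigma>"
    then show ?thesis using can_acc_Box[of w v A] JK sub(5)[OF JK(2)] by simp
  qed
  show "Dia A \<in> label J" if JK: "(J, K) \<in> world_acc" "Dia A \<in> \<Sigma>" "A \<in> label K \<or> Dia A \<in> label K" for J K A
  proof (rule acc_label[OF JK(1)])
    fix w v assume "prime w" "can_acc w v" "label J = w \<inter> \<Sigma>" "label K = v \<inter> \<Sigma>"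
    then show ?thesis using can_acc_Dia[of w v A] JK by auto
  qed
  show "\<exists>K M. (J, K) \<in> world_le_rel \<and> (K, M) \<in> world_acc \<and> A \<notin> label M"
    if "J \<in> worlds1" "Box A \<in> \<Sigma>" "Box A \<notin> label J" for J A
    using that by (rule world_box_witness)
  show "\<exists>K. (J, K) \<in> world_acc \<and> A \<in> label K"
    if "J \<in> worlds1" "Dia A \<in> \<Sigma>" "Dia A \<in> label J" for J A
    by (rule world_dia_witness[OF that(1) sub(4)[OF that(2)] that(3)])
qed

lemma world_of_prime:
  assumes "prime w"
  obtains J where "J \<in> worlds1" "label J = w \<inter> \<Sigma>"
proof -
  have "tree {[]}" "realizes (\<lambda>_. w) {[]}"
    using assms by (auto simp: tree_def realizes_def)
  then have "realizable {[]} (\<lambda>_. w \<inter> \<Sigma>)" unfolding realizable_def by blast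
  then have "({[]}, \<lambda>_. w \<inter> \<Sigma>, [[]]) \<in> pts1" by (auto simp: pts1_def)
  then obtain J where J: "max_ideal pattern_le pts1 J" "({[]}, \<lambda>_. w \<inter> \<Sigma>, [[]]) \<in> J"
    using mem_max_ideal[OF order1] by blast
  then show thesis
    using that[of J] label_eq[OF max_ideal_ideal] by (auto simp: worlds1_def)
qed

end

theorem theorem15p5:
  fixes \<phi> :: "'p fm"
  assumes "countable (UNIV :: 'p set)" and "infinite (UNIV :: 'p set)"
    and "\<phi> \<notin> IK4"
  shows "\<exists>M :: (nat, 'p) model. int_trans_model M \<and> finite (worlds M) \<and>
    (\<exists>w \<in> worlds M. \<not> holds M \<phi> w)"
proof -
  interpret ik4_patterns "UNIV :: 'p set" "subfms \<phi>"
    by unfold_locales (simp_all add: assms(2) finite_subfms)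
  interpret quasimodel worlds1 world_le_rel world_acc label "subfms \<phi>"
    by (rule quasimodel_worlds[OF subformula_closed_subfms])
  obtain w where w: "prime w" "\<phi> \<notin> w"
    using prime_avoiding[OF ik4_theory_IK4 assms(3)] by blast
  obtain J where J: "J \<in> worlds1" "label J = w \<inter> subfms \<phi>"
    using world_of_prime[OF w(1)] by blast
  obtain M :: "(nat, 'p) model" where M: "int_trans_model M" "finite (worlds M)"
    "\<forall>x\<in>worlds1. \<exists>w\<in>worlds M. \<forall>A\<in>subfms \<phi>. holds M A w \<longleftrightarrow> A \<in> label x"
    using finite_model by blast
  then obtain v where "v \<in> worlds M" "holds M \<phi> v \<longleftrightarrow> \<phi> \<in> label J"
    using J(1) subfms_refl by blast
  then have "\<not> holds M \<phi> v" using J(2) w(2) by simp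
  then show ?thesis using M(1,2) \<open>v \<in> worlds M\<close> by blast
qed

end
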